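(* Let $s\in\{s_1,\dots,s_m\}$ be an interior knot of $p_0$. Then there exists a unique minimizer of $$\Phi^{\ge s}(g)=\frac12\sum_{k=s}^{S+1}(g(k)-\mathbb W(k))^2$$ over $\mathcal C^{\ge s}(\mathcal K)$, the set of vectors $g=(g(s),\dots,g(S+1))$ that are convex on $\{s_j,\dots,s_{j+1}\}$ for every $j\in\{0,\dots,m\}$ with $s_j\ge s$. This minimizer equals $(\hat g(s),\dots,\hat g(S+1))$ if and only if $\widehat{\mathbb G}(s-1)=\mathbb U(F_{p_0}(s-1))$. Moreover, $\sqrt n\big(\hat p_n(s)-p_0(s),\dots,\hat p_n(S+1)-p_0(S+1)\big)$ converges in distribution to the minimizer of $\Phi^{\ge s}$ over $\mathcal C^{\ge s}(\mathcal K)$ if and only if $F_{\hat p_n}(s-1)=F_{p_n}(s-1)+o_p(n^{-1/2})$.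
   Context: Let $\mathbb N=\{0,1,\dots\}$. For a real sequence $p$ and $k\ge1$ let $\Delta p(k)=p(k+1)-2p(k)+p(k-1)$; $p$ is convex if $\Delta p(k)\ge0$ for all $k\ge1$; $\mathcal C$ is the set of convex sequences with $\sum_kp(k)^2<\infty$. A knot of $p$ is an integer $k\ge1$ with $\Delta p(k)>0$. For a sequence $p$ let $F_p(k)=\sum_{j=0}^kp(j)$ ($F_p(-1)=0$). Let $p_0$ be a convex probability mass function on $\mathbb N$ with finite support $\{0,\dots,S\}$, $S\ge1$. Let $X_1,X_2,\dots$ be i.i.d. with pmf $p_0$, $p_n(j)=\frac1n\sum_{i\le n}\mathbb 1\{X_i=j\}$, and let $\hat p_n$ be the unique minimizer over $\mathcal C$ of $\frac12\sum_j(p_n(j)-p(j))^2$. Let $\mathbb U$ be a standard Brownian bridge on $[0,1]$, $\mathbb W(k)=\mathbb U(F_{p_0}(k))-\mathbb U(F_{p_0}(k-1))$ for $k\in\{0,\dots,S+1\}$. Let $s_1<\dots<s_m$ ($m\ge1$) be the knots of $p_0$ in $\{1,\dots,S\}$, $s_0=0$, $s_{m+1}=S+1$, $\mathcal K=\{s_1,\dots,s_m\}$. A vector $g$ is convex on $\{a,\dots,b\}$ if $g(k+1)-2g(k)+g(k-1)\ge0$ for $a<k<b$; $\mathcal C(\mathcal K)$ is the set of $g\in\mathbb R^{S+2}$ (indexed $0,\dots,S+1$) convex on $\{s_j,\dots,s_{j+1}\}$ for all $j=0,\dots,m$. Let $\hat g$ be the unique minimizer over $\mathcal C(\mathcal K)$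 of $\frac12\sum_{k=0}^{S+1}(g(k)-\mathbb W(k))^2$, and $\widehat{\mathbb G}(x)=\sum_{k=0}^x\hat g(k)$. The first two assertions hold for each realization of $\mathbb U$. *)

theory Defs
  imports "HOL-Probability.Probability"
begin

definition dd :: "(nat \<Rightarrow> real) \<Rightarrow> nat \<Rightarrow> real" where
  "dd p k = p (Suc k) - 2 * p k + p (k - 1)"

definition convex_seq :: "(nat \<Rightarrow> real) \<Rightarrow> bool" where
  "convex_seq p \<longleftrightarrow> (\<forall>k\<ge>1. dd p k \<ge> 0)"

definition convex_seqs :: "(nat \<Rightarrow> real) set" where
  "convex_seqs = {p. convex_seq p \<and> summable (\<lambda>k. (p k)^2)}"

definition knot :: "(nat \<Rightarrow> real) \<Rightarrow> nat \<Rightarrow> bool" where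
  "knot p k \<longleftrightarrow> k \<ge> 1 \<and> dd p k > 0"

definition Fp :: "(nat \<Rightarrow> real) \<Rightarrow> int \<Rightarrow> real" where
  "Fp p k = (if k < 0 then 0 else (\<Sum>j\<le>nat k. p j))"

definition emp_pmf :: "(nat \<Rightarrow> 'a \<Rightarrow> nat) \<Rightarrow> nat \<Rightarrow> 'a \<Rightarrow> nat \<Rightarrow> real" where
  "emp_pmf X n \<omega> j = real (card {i\<in>{1..n}. X i \<omega> = j}) / real n"

definition lsq_obj :: "(nat \<Rightarrow> real) \<Rightarrow> (nat \<Rightarrow> real) \<Rightarrow> real" where
  "lsq_obj q p = (1/2) * (\<Sum>j. (q j - p j)^2)"

definition hat_p :: "(nat \<Rightarrow> real) \<Rightarrow> nat \<Rightarrow> real" where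
  "hat_p q = (THE p. p \<in> convex_seqs \<and> (\<forall>p'\<in>convex_seqs. lsq_obj q p \<le> lsq_obj q p'))"

definition knotset :: "(nat \<Rightarrow> real) \<Rightarrow> nat \<Rightarrow> nat set" where
  "knotset p0 S = {k\<in>{1..S}. knot p0 k}"

definition sknot :: "(nat \<Rightarrow> real) \<Rightarrow> nat \<Rightarrow> nat \<Rightarrow> nat" where
  "sknot p0 S j = sorted_list_of_set ({0} \<union> knotset p0 S \<union> {S+1}) ! j"

definition convex_between :: "(nat \<Rightarrow> real) \<Rightarrow> nat \<Rightarrow> nat \<Rightarrow> bool" where
  "convex_between g a b \<longleftrightarrow> (\<forall>k. a < k \<and> k < b \<longrightarrow> dd g k \<ge> 0)"

text \<open>C(K): vectors indexed by 0..S+1 (represented as functions vanishing beyond S+1).\<close>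
definition CK :: "(nat \<Rightarrow> real) \<Rightarrow> nat \<Rightarrow> (nat \<Rightarrow> real) set" where
  "CK p0 S = {g. (\<forall>k>S+1. g k = 0) \<and>
     (\<forall>j\<le>card (knotset p0 S). convex_between g (sknot p0 S j) (sknot p0 S (Suc j)))}"

text \<open>C^{>=s}(K): vectors indexed by s..S+1 (functions vanishing outside {s..S+1}).\<close>
definition CKge :: "(nat \<Rightarrow> real) \<Rightarrow> nat \<Rightarrow> nat \<Rightarrow> (nat \<Rightarrow> real) set" where
  "CKge p0 S s = {g. (\<forall>k. k \<notin> {s..S+1} \<longrightarrow> g k = 0) \<and>
     (\<forall>j\<le>card (knotset p0 S). sknot p0 S j \<ge> s \<longrightarrow>
        convex_between g (sknot p0 S j) (sknot p0 S (Suc j)))}"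

definition Wvec :: "(nat \<Rightarrow> real) \<Rightarrow> (real \<Rightarrow> real) \<Rightarrow> nat \<Rightarrow> real" where
  "Wvec p0 u k = u (Fp p0 (int k)) - u (Fp p0 (int k - 1))"

definition Phi :: "nat \<Rightarrow> (nat \<Rightarrow> real) \<Rightarrow> (nat \<Rightarrow> real) \<Rightarrow> real" where
  "Phi S W g = (1/2) * (\<Sum>k\<in>{0..S+1}. (g k - W k)^2)"

definition Phi_ge :: "nat \<Rightarrow> nat \<Rightarrow> (nat \<Rightarrow> real) \<Rightarrow> (nat \<Rightarrow> real) \<Rightarrow> real" where
  "Phi_ge S s W g = (1/2) * (\<Sum>k\<in>{s..S+1}. (g k - W k)^2)"

definition ghat :: "(nat \<Rightarrow> real) \<Rightarrow> nat \<Rightarrow> (nat \<Rightarrow> real) \<Rightarrow> nat \<Rightarrow> real" where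
  "ghat p0 S W = (THE g. g \<in> CK p0 S \<and> (\<forall>g'\<in>CK p0 S. Phi S W g \<le> Phi S W g'))"

definition Ghat :: "(nat \<Rightarrow> real) \<Rightarrow> nat \<Rightarrow> (nat \<Rightarrow> real) \<Rightarrow> nat \<Rightarrow> real" where
  "Ghat p0 S W x = (\<Sum>k\<le>x. ghat p0 S W k)"

definition gmin_ge :: "(nat \<Rightarrow> real) \<Rightarrow> nat \<Rightarrow> nat \<Rightarrow> (nat \<Rightarrow> real) \<Rightarrow> nat \<Rightarrow> real" where
  "gmin_ge p0 S s W = (THE g. g \<in> CKge p0 S s \<and>
      (\<forall>g'\<in>CKge p0 S s. Phi_ge S s W g \<le> Phi_ge S s W g'))"

text \<open>Standard Brownian bridge on [0,1]: continuous paths pinned at 0 and 1, and centred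
  Gaussian finite-dimensional distributions with covariance min(s,t) - s t
  (every linear combination is centred normal with the corresponding variance,
  expressed through its characteristic function).\<close>
definition brownian_bridge :: "'b measure \<Rightarrow> ('b \<Rightarrow> real \<Rightarrow> real) \<Rightarrow> bool" where
  "brownian_bridge N U \<longleftrightarrow> prob_space N \<and>
     (\<forall>t\<in>{0..1}. (\<lambda>\<omega>. U \<omega> t) \<in> borel_measurable N) \<and>
     (\<forall>\<omega>\<in>space N. continuous_on {0..1} (U \<omega>) \<and> U \<omega> 0 = 0 \<and> U \<omega> 1 = 0) \<and>
     (\<forall>(n::nat) (t::nat \<Rightarrow> real) (a::nat \<Rightarrow> real). (\<forall>i<n. t i \<in> {0..1}) \<longrightarrow>
        (\<forall>\<theta>. char (distr N borel (\<lambda>\<omega>. \<Sum>i<n. a i * U \<omega> (t i))) \<theta> =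
           complex_of_real (exp (- (\<theta>^2 / 2) *
             (\<Sum>i<n. \<Sum>j<n. a i * a j * (min (t i) (t j) - t i * t j))))))"

text \<open>Convergence in distribution of random vectors (nat \<Rightarrow> real, product topology),
  possibly defined on different probability spaces: convergence of expectations of
  all bounded continuous test functions.\<close>
definition conv_distr :: "'a measure \<Rightarrow> (nat \<Rightarrow> 'a \<Rightarrow> (nat \<Rightarrow> real)) \<Rightarrow>
    'b measure \<Rightarrow> ('b \<Rightarrow> (nat \<Rightarrow> real)) \<Rightarrow> bool" where
  "conv_distr M Y N Z \<longleftrightarrow>
     (\<forall>f :: (nat \<Rightarrow> real) \<Rightarrow> real. continuous_on UNIV f \<and> bounded (range f) \<longrightarrow>
        (\<lambda>n. \<integral>\<omega>. f (Y n \<omega>) \<partial>M) \<longlonglongrightarrow> (\<integral>\<omega>. f (Z \<omega>) \<partial>N))"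

definition o_p_one :: "'a measure \<Rightarrow> (nat \<Rightarrow> 'a \<Rightarrow> real) \<Rightarrow> bool" where
  "o_p_one M R \<longleftrightarrow>
     (\<forall>\<epsilon>>0. (\<lambda>n. measure M {\<omega>\<in>space M. \<bar>R n \<omega>\<bar> > \<epsilon>}) \<longlonglongrightarrow> 0)"

end

theory Submission
  imports Defs
begin

text \<open>Write \<open>W\<^sub>n = n\<^sup>1\<^sup>/\<^sup>2 (p\<^sub>n - p\<^sub>0)\<close> and let \<open>D(w)\<close> be the sum over \<open>k < s\<close> of \<open>g(k) - w(k)\<close>, where \<open>g\<close> is the
  projection of \<open>w\<close> onto the cone \<open>C(K)\<close>. Because the second difference at the knot \<open>s\<close> is free, vectors of
  the tail cone extend to \<open>C(K)\<close> by a constant on the left, and comparing the variational inequalities of the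
  two projections shows that the tail of \<open>g\<close> is the tail projection iff \<open>D(w) = 0\<close>; moreover \<open>D \<le> 0\<close>.

  As soon as \<open>p\<^sub>n\<close> is close to \<open>p\<^sub>0\<close>, the strict convexity constraints at the knots are inactive and the
  estimator \<open>q\<^sub>n\<close> satisfies \<open>n\<^sup>1\<^sup>/\<^sup>2 (q\<^sub>n - p\<^sub>0) = g\<close> for \<open>w = W\<^sub>n\<close>, exactly. By the multivariate central limit theorem both
  its tail and \<open>D(W\<^sub>n) = n\<^sup>1\<^sup>/\<^sup>2 (F\<^bsub>q\<^sub>n\<^esub>(s-1) - F\<^bsub>p\<^sub>n\<^esub>(s-1))\<close> converge in law, so each side of the final
  equivalence amounts to \<open>D(W) = 0\<close> almost surely. For the convergence of the tails this uses the sign of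
  \<open>D\<close>: the tail of \<open>g\<close> has total mass \<open>Y - D\<close> and the tail projection has mass \<open>Y\<close>, where \<open>Y\<close>
  is the tail mass of \<open>W\<close>, and \<open>Y - D \<ge> Y\<close> with equal laws forces \<open>D = 0\<close>.\<close>

section \<open>Projection onto closed convex cones\<close>

text \<open>Tychonoff's theorem for the product topology that the function type carries. Vectors are
  coded as functions on all of \<open>nat\<close>, so the compactness of finite-dimensional boxes
  comes from here.\<close>

lemma compact_box_fun:
  fixes A :: "nat \<Rightarrow> real set"
  assumes "\<And>k. compact (A k)"
  shows "compact {x. \<forall>k. x k \<in> A k}"
proof -
  have "compactin (product_topology (\<lambda>_. euclidean) UNIV) (PiE UNIV A)"
    using assms by (simp add: compactin_PiE)
  moreover have "PiE UNIV A = {x. \<forall>k. x k \<in> A k}"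
    by (auto simp: PiE_def Pi_def)
  ultimately show ?thesis
    by (simp add: euclidean_product_topology)
qed

text \<open>Vectors indexed by \<open>I\<close> are functions vanishing off \<open>I\<close>, which
  makes minimizers unique as functions. The full cone \<open>CK\<close> and the tail cone
  \<open>CKge\<close> are the two instances.\<close>

locale finite_cone =
  fixes I :: "nat set" and C :: "(nat \<Rightarrow> real) set"
  assumes finite_I: "finite I"
    and support: "g \<in> C \<Longrightarrow> k \<notin> I \<Longrightarrow> g k = 0"
    and closed_C: "closed C"
    and zero: "(\<lambda>_. 0) \<in> C"
    and add: "g \<in> C \<Longrightarrow> h \<in> C \<Longrightarrow> (\<lambda>k. g k + h k) \<in> C"
    and scale: "g \<in> C \<Longrightarrow> 0 \<le> c \<Longrightarrow> (\<lambda>k. c * g k) \<in> C"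
begin

definition obj :: "(nat \<Rightarrow> real) \<Rightarrow> (nat \<Rightarrow> real) \<Rightarrow> real" where
  "obj w g = (1/2) * (\<Sum>k\<in>I. (g k - w k)\<^sup>2)"

text \<open>The variational characterization of the projection onto a convex cone: the residual
  \<open>g - w\<close> lies in the dual cone and is orthogonal to \<open>g\<close>.\<close>

definition is_proj :: "(nat \<Rightarrow> real) \<Rightarrow> (nat \<Rightarrow> real) \<Rightarrow> bool" where
  "is_proj w g \<longleftrightarrow> g \<in> C \<and> (\<forall>h\<in>C. 0 \<le> (\<Sum>k\<in>I. (g k - w k) * h k))
     \<and> (\<Sum>k\<in>I. (g k - w k) * g k) = 0"

text \<open>Competitors no worse than the zero vector lie in a compact box \<open>B\<close>, where
  the continuous objective attains its minimum; all others lose to the zero vector.\<close>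

lemma ex_minimizer: "\<exists>g\<in>C. \<forall>h\<in>C. obj w g \<le> obj w h"
proof -
  define R where "R = 1 + sqrt (2 * obj w (\<lambda>_. 0))"
  define B where "B = {x :: nat \<Rightarrow> real. \<forall>k. x k \<in> (if k \<in> I then {w k - R..w k + R} else {0})}"
  have nn: "0 \<le> obj w g" for g by (simp add: obj_def sum_nonneg)
  have inB: "g \<in> B" if g: "g \<in> C" "obj w g \<le> obj w (\<lambda>_. 0)" for g
  proof -
    have "\<bar>g k - w k\<bar> \<le> R" if k: "k \<in> I" for k
    proof -
      have "(g k - w k)\<^sup>2 \<le> (\<Sum>k\<in>I. (g k - w k)\<^sup>2)"
        using finite_I k by (intro member_le_sum) auto
      also have "\<dots> \<le> 2 * obj w (\<lambda>_. 0)" using g(2) by (simp add: obj_def)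
      finally have "\<bar>g k - w k\<bar> \<le> sqrt (2 * obj w (\<lambda>_. 0))"
        by (simp add: real_le_rsqrt)
      then show ?thesis by (simp add: R_def)
    qed
    then show ?thesis using support[OF g(1)] by (fastforce simp: B_def abs_le_iff)
  qed
  have cont: "continuous_on A (obj w)" for A
    unfolding obj_def by (intro continuous_intros)
       (auto intro: continuous_on_product_coordinates continuous_on_subset)
  have "compact (C \<inter> B)"
    unfolding B_def by (intro closed_Int_compact closed_C compact_box_fun) auto
  moreover have "C \<inter> B \<noteq> {}" using inB[of "\<lambda>_. 0"] zero by blast
  ultimately obtain g where g: "g \<in> C \<inter> B" "\<And>h. h \<in> C \<inter> B \<Longrightarrow> obj w g \<le> obj w h"
    using continuous_attains_inf[OF _ _ cont] by metis
  have "obj w g \<le> obj w h" if h: "h \<in> C" for h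
  proof (cases "obj w h \<le> obj w (\<lambda>_. 0)")
    case True then show ?thesis using g(2) inB h by blast
  next
    case False
    moreover have "obj w g \<le> obj w (\<lambda>_. 0)" using g(2) inB[of "\<lambda>_. 0"] zero by blast
    ultimately show ?thesis by linarith
  qed
  then show ?thesis using g(1) by blast
qed

lemma obj_expand:
  "obj w h = obj w g + (\<Sum>k\<in>I. (g k - w k) * (h k - g k)) + (1/2) * (\<Sum>k\<in>I. (h k - g k)\<^sup>2)"
  unfolding obj_def sum_distrib_left sum.distrib[symmetric]
  by (intro sum.cong refl) (simp add: power2_eq_square algebra_simps)

text \<open>In the expansion around \<open>g\<close> the linear term is the pairing of the residual
  with \<open>h\<close>, which is nonnegative, minus its pairing with \<open>g\<close>, which is
  zero. The quadratic gain gives uniqueness and, later, the comparison of the estimator with every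
  convex sequence.\<close>

lemma obj_diff_bound:
  assumes "is_proj w g" "h \<in> C"
  shows "obj w g + (1/2) * (\<Sum>k\<in>I. (h k - g k)\<^sup>2) \<le> obj w h"
proof -
  have "0 \<le> (\<Sum>k\<in>I. (g k - w k) * (h k - g k))"
    using assms by (simp add: is_proj_def right_diff_distrib sum_subtractf)
  then show ?thesis using obj_expand[of w h g] by linarith
qed

lemma minimizer_variation:
  assumes g: "g \<in> C" "\<And>h. h \<in> C \<Longrightarrow> obj w g \<le> obj w h"
    and v: "\<And>t. 0 < t \<Longrightarrow> t \<le> 1 \<Longrightarrow> (\<lambda>k. g k + t * v k) \<in> C"
  shows "0 \<le> (\<Sum>k\<in>I. (g k - w k) * v k)"
proof (rule ccontr)
  define a b where "a = (\<Sum>k\<in>I. (g k - w k) * v k)" and "b = (\<Sum>k\<in>I. (v k)\<^sup>2)"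
  assume "\<not> ?thesis"
  then have a: "a < 0" by (simp add: a_def)
  have b: "0 \<le> b" by (simp add: b_def sum_nonneg)
  \<comment> \<open>This step length ensures \<open>t * b \<le> - a\<close>, so the slope
    \<open>a < 0\<close> dominates the quadratic contribution \<open>t * b / 2\<close>.\<close>
  define t where "t = min 1 (- a / (b + 1))"
  have t: "0 < t" "t \<le> 1" using a b by (auto simp: t_def divide_neg_pos)
  have "obj w (\<lambda>k. g k + t * v k) = obj w g + t * a + (1/2) * (t\<^sup>2 * b)"
    by (subst obj_expand[of _ _ g])
       (simp add: a_def b_def sum_distrib_left power_mult_distrib mult_ac)
  with g(2)[OF v[OF t]] have "0 \<le> t * a + (1/2) * (t\<^sup>2 * b)" by simp
  then have "0 \<le> t * (a + t * b / 2)" by (simp add: power2_eq_square algebra_simps)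
  then have "0 \<le> a + t * b / 2" using t(1) by (simp add: zero_le_mult_iff)
  moreover have "t * b \<le> - a"
  proof -
    have "t * b \<le> (- a / (b + 1)) * b" using b by (intro mult_right_mono) (auto simp: t_def)
    also have "\<dots> \<le> - a" using a b by (simp add: field_simps)
    finally show ?thesis .
  qed
  ultimately show False using a by linarith
qed

lemma is_proj_iff:
  "is_proj w g \<longleftrightarrow> g \<in> C \<and> (\<forall>h\<in>C. obj w g \<le> obj w h)"
proof
  assume p: "is_proj w g"
  have "obj w g \<le> obj w h" if "h \<in> C" for h
  proof -
    have "0 \<le> (\<Sum>k\<in>I. (h k - g k)\<^sup>2)" by (simp add: sum_nonneg)
    with obj_diff_bound[OF p that] show ?thesis by simp
  qed
  with p show "g \<in> C \<and> (\<forall>h\<in>C. obj w g \<le> obj w h)" by (simp add: is_proj_def)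
next
  assume m: "g \<in> C \<and> (\<forall>h\<in>C. obj w g \<le> obj w h)"
  have 1: "0 \<le> (\<Sum>k\<in>I. (g k - w k) * h k)" if "h \<in> C" for h
    using m that by (intro minimizer_variation) (auto intro!: add scale)
  \<comment> \<open>Shrinking \<open>g\<close> towards zero stays in the cone as long as
    \<open>t \<le> 1\<close>, so \<open>- g\<close> is an admissible direction; together with the
    direction \<open>g\<close> it forces orthogonality.\<close>
  have "0 \<le> (\<Sum>k\<in>I. (g k - w k) * (- g k))"
  proof (intro minimizer_variation)
    fix t :: real assume "0 < t" "t \<le> 1"
    then have "(\<lambda>k. (1 - t) * g k) \<in> C" using m by (intro scale) auto
    then show "(\<lambda>k. g k + t * - g k) \<in> C" by (simp add: algebra_simps)
  qed (use m in auto)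
  then have "(\<Sum>k\<in>I. (g k - w k) * g k) \<le> 0" by (simp add: sum_negf)
  with 1 m show "is_proj w g" unfolding is_proj_def by force
qed

lemma is_proj_unique:
  assumes "is_proj w g" "is_proj w h"
  shows "g = h"
proof -
  have "(\<Sum>k\<in>I. (h k - g k)\<^sup>2) \<le> 0"
    using obj_diff_bound[of w g h] assms is_proj_iff by fastforce
  then have "(\<Sum>k\<in>I. (h k - g k)\<^sup>2) = 0" by (simp add: sum_nonneg order_antisym)
  then have "\<forall>k\<in>I. h k = g k" using finite_I by (simp add: sum_nonneg_eq_0_iff)
  then show ?thesis using assms support unfolding is_proj_def by (metis ext)
qed

section \<open>The projection map and its continuity\<close>

lemma ex1_proj: "\<exists>!g. is_proj w g"
  using ex_minimizer[of w] is_proj_iff is_proj_unique by blast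

text \<open>This \<open>THE\<close> expression has the shape of \<open>ghat\<close> and
  \<open>gmin_ge\<close>, so that both are identified with projections by unfolding.\<close>

definition proj :: "(nat \<Rightarrow> real) \<Rightarrow> nat \<Rightarrow> real" where
  "proj w = (THE g. g \<in> C \<and> (\<forall>h\<in>C. obj w g \<le> obj w h))"

lemma is_proj_proj: "is_proj w (proj w)"
  using theI'[OF ex1_proj[of w]] by (simp add: proj_def is_proj_iff)

lemma proj_eqI: "is_proj w g \<Longrightarrow> proj w = g"
  using is_proj_proj is_proj_unique by blast

lemma proj_in: "proj w \<in> C"
  using is_proj_proj is_proj_def by blast

lemma proj_test: "h \<in> C \<Longrightarrow> 0 \<le> (\<Sum>k\<in>I. (proj w k - w k) * h k)"
  using is_proj_proj is_proj_def by blast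

lemma proj_self: "(\<Sum>k\<in>I. (proj w k - w k) * proj w k) = 0"
  using is_proj_proj is_proj_def by blast

text \<open>Testing each projection against the other and adding bounds the squared norm of the
  difference \<open>x\<close> by the inner product of \<open>w - v\<close> with \<open>x\<close>;
  the inequality \<open>2ab \<le> a^2 + b^2\<close> then leaves half of that norm to be
  absorbed.\<close>

lemma proj_lipschitz:
  "(\<Sum>k\<in>I. (proj w k - proj v k)\<^sup>2) \<le> (\<Sum>k\<in>I. (w k - v k)\<^sup>2)"
proof -
  define x where "x k = proj w k - proj v k" for k
  have "0 \<le> (\<Sum>k\<in>I. (proj w k - w k) * proj v k)" "0 \<le> (\<Sum>k\<in>I. (proj v k - v k) * proj w k)"
    by (intro proj_test proj_in)+
  moreover have "(\<Sum>k\<in>I. x k * x k) = (\<Sum>k\<in>I. (w k - v k) * x k)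
      + ((\<Sum>k\<in>I. (proj w k - w k) * proj w k) + (\<Sum>k\<in>I. (proj v k - v k) * proj v k)
      - (\<Sum>k\<in>I. (proj w k - w k) * proj v k) - (\<Sum>k\<in>I. (proj v k - v k) * proj w k))"
    unfolding sum.distrib[symmetric] sum_subtractf[symmetric]
    by (intro sum.cong refl) (simp add: x_def algebra_simps)
  ultimately have "(\<Sum>k\<in>I. x k * x k) \<le> (\<Sum>k\<in>I. (w k - v k) * x k)"
    using proj_self[of w] proj_self[of v] by linarith
  moreover have "(\<Sum>k\<in>I. (w k - v k) * x k) \<le> (\<Sum>k\<in>I. ((w k - v k)\<^sup>2 + x k * x k) / 2)"
  proof (intro sum_mono)
    fix k
    have "2 * (w k - v k) * x k \<le> (w k - v k)\<^sup>2 + (x k)\<^sup>2" by (rule sum_squares_bound)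
    then show "(w k - v k) * x k \<le> ((w k - v k)\<^sup>2 + x k * x k) / 2" by (simp add: power2_eq_square algebra_simps)
  qed
  ultimately have "(\<Sum>k\<in>I. x k * x k) \<le> (\<Sum>k\<in>I. (w k - v k)\<^sup>2)"
    by (simp add: sum.distrib sum_divide_distrib[symmetric])
  then show ?thesis by (simp add: x_def power2_eq_square)
qed

text \<open>Nonexpansiveness against the zero vector, which is its own projection. It later turns
  closeness of \<open>q\<close> to \<open>p0\<close> into smallness of the perturbation of
  \<open>p0\<close>.\<close>

lemma proj_norm_le: "(\<Sum>k\<in>I. (proj w k)\<^sup>2) \<le> (\<Sum>k\<in>I. (w k)\<^sup>2)"
proof -
  have "is_proj (\<lambda>_. 0) (\<lambda>_. 0)" by (simp add: is_proj_def zero)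
  then have "proj (\<lambda>_. 0) = (\<lambda>_. 0)" by (rule proj_eqI)
  then show ?thesis using proj_lipschitz[of w "\<lambda>_. 0"] by simp
qed

text \<open>Nonexpansiveness controls each coordinate in \<open>I\<close> by a distance that
  involves finitely many coordinates only, and such a distance is continuous in the product
  topology.\<close>

lemma continuous_on_proj: "continuous_on UNIV proj"
proof (rule continuous_on_coordinatewise_then_product)
  fix k
  show "continuous_on UNIV (\<lambda>w. proj w k)"
  proof (cases "k \<in> I")
    case False
    then have "proj w k = 0" for w using support[OF proj_in] by auto
    then show ?thesis by simp
  next
    case True
    have "((\<lambda>w. proj w k) \<longlongrightarrow> proj v k) (at v)" for v
    proof -
      have coord: "((\<lambda>w. w j) \<longlongrightarrow> v j) (at v)" for j
      proof -
        have "continuous_on UNIV (\<lambda>w :: nat \<Rightarrow> real. w j)"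
          by (rule continuous_on_product_coordinates)
        then show ?thesis by (simp add: continuous_on_def)
      qed
      have "((\<lambda>w. sqrt (\<Sum>k\<in>I. (w k - v k)\<^sup>2)) \<longlongrightarrow> sqrt (\<Sum>k\<in>I. (v k - v k)\<^sup>2)) (at v)"
        by (intro tendsto_intros coord)
      then have "((\<lambda>w. sqrt (\<Sum>k\<in>I. (w k - v k)\<^sup>2)) \<longlongrightarrow> 0) (at v)" by simp
      moreover have "dist (proj w k) (proj v k) \<le> sqrt (\<Sum>k\<in>I. (w k - v k)\<^sup>2)" for w
      proof -
        have "(proj w k - proj v k)\<^sup>2 \<le> (\<Sum>k\<in>I. (proj w k - proj v k)\<^sup>2)"
          using True finite_I by (intro member_le_sum) auto
        also note proj_lipschitz
        finally show ?thesis by (simp add: dist_real_def real_le_rsqrt)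
      qed
      ultimately have "((\<lambda>w. dist (proj w k) (proj v k)) \<longlongrightarrow> 0) (at v)"
        by (simp add: Lim_null_comparison[where g="\<lambda>w. sqrt (\<Sum>k\<in>I. (w k - v k)\<^sup>2)"])
      then show ?thesis by (simp only: tendsto_dist_iff[of _ "proj v k"])
    qed
    then show ?thesis by (simp add: continuous_on_def)
  qed
qed

end

section \<open>The cones of piecewise convex vectors\<close>

lemma sorted_nth_gap:
  fixes xs :: "'a::linorder list"
  assumes "sorted_wrt (<) xs" "Suc j < length xs" "xs ! j < k" "k < xs ! Suc j"
  shows "k \<notin> set xs"
proof
  assume "k \<in> set xs"
  then obtain i where i: "i < length xs" "xs ! i = k" by (metis in_set_conv_nth)
  have "strict_mono_on {..<length xs} (\<lambda>i. xs ! i)"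
    using assms(1) by (auto simp: strict_mono_on_def sorted_wrt_iff_nth_less)
  with assms i have "j < i" "i < Suc j"
    by (auto simp: strict_mono_on_less)
  then show False by simp
qed

lemma sorted_nth_gap_ex:
  fixes xs :: "'a::linorder list"
  assumes "a \<in> set xs" "b \<in> set xs" "sorted_wrt (<) xs" "a < k" "k < b" "k \<notin> set xs"
  shows "\<exists>j. Suc j < length xs \<and> a \<le> xs ! j \<and> xs ! j < k \<and> k < xs ! Suc j"
proof -
  obtain i0 where i0: "i0 < length xs" "xs ! i0 = a" using assms by (metis in_set_conv_nth)
  obtain i1 where i1: "i1 < length xs" "xs ! i1 = b" using assms by (metis in_set_conv_nth)
  have mono: "strict_mono_on {..<length xs} (\<lambda>i. xs ! i)"
    using assms(3) by (auto simp: strict_mono_on_def sorted_wrt_iff_nth_less)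
  \<comment> \<open>The last index whose entry is below \<open>k\<close>; as \<open>k\<close> is
    itself no entry, the next entry lies above it.\<close>
  define j where "j = Max {i. i < length xs \<and> xs ! i < k}"
  have fin: "finite {i. i < length xs \<and> xs ! i < k}" by simp
  have "j \<in> {i. i < length xs \<and> xs ! i < k}"
    unfolding j_def by (rule Max_in) (use fin i0 assms in auto)
  then have j: "j < length xs" "xs ! j < k" by auto
  have "i0 \<le> j" unfolding j_def using fin i0 assms by (intro Max_ge) auto
  then have a: "a \<le> xs ! j" using mono i0 j
    by (metis lessThan_iff strict_mono_on_less_eq)
  have "j < i1"
    using mono i1 j assms(5) by (metis lessThan_iff strict_mono_on_less order.strict_trans)
  then have Sj: "Suc j < length xs" using i1 by simp
  have "\<not> xs ! Suc j < k"
  proof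
    assume "xs ! Suc j < k"
    then have "Suc j \<le> j" unfolding j_def using fin Sj by (intro Max_ge) (auto simp: j_def)
    then show False by simp
  qed
  moreover have "xs ! Suc j \<noteq> k" using Sj assms(6) nth_mem by metis
  ultimately show ?thesis using a j Sj by fastforce
qed

section \<open>The cones described by pointwise conditions on second differences\<close>

context
  fixes p0 :: "nat \<Rightarrow> real" and S :: nat
begin

definition knot_list :: "nat list" where
  "knot_list = sorted_list_of_set ({0} \<union> knotset p0 S \<union> {S+1})"

lemma finite_knotset [simp]: "finite (knotset p0 S)"
  by (simp add: knotset_def)

lemma knotset_subset: "knotset p0 S \<subseteq> {1..S}"
  by (auto simp: knotset_def)

lemma set_knot_list: "set knot_list = {0} \<union> knotset p0 S \<union> {S+1}"
  unfolding knot_list_def by (rule set_sorted_list_of_set) simp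

lemma length_knot_list: "length knot_list = card (knotset p0 S) + 2"
proof -
  have "0 \<notin> knotset p0 S" "S + 1 \<notin> insert 0 (knotset p0 S)"
    using knotset_subset by auto
  then show ?thesis by (simp add: knot_list_def)
qed

lemma sorted_knot_list: "sorted_wrt (<) knot_list"
  unfolding knot_list_def by (rule strict_sorted_list_of_set)

lemma sknot_nth: "sknot p0 S j = knot_list ! j"
  by (simp only: sknot_def knot_list_def)

text \<open>A point lies strictly inside some interval between consecutive knots exactly if it is
  not a knot, so the condition indexed by pieces becomes one indexed by points. The case
  \<open>a = 0\<close> describes \<open>CK\<close>, the case \<open>a = s\<close> describes
  \<open>CKge\<close>.\<close>

lemma convex_pieces_iff:
  assumes "a \<in> {0} \<union> knotset p0 S"
  shows "(\<forall>j\<le>card (knotset p0 S). a \<le> sknot p0 S j \<longrightarrow>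
        convex_between g (sknot p0 S j) (sknot p0 S (Suc j)))
      \<longleftrightarrow> (\<forall>k. a < k \<longrightarrow> k \<le> S \<longrightarrow> k \<notin> knotset p0 S \<longrightarrow> 0 \<le> dd g k)" (is "?L \<longleftrightarrow> ?R")
proof
  assume L: ?L
  show ?R
  proof (intro allI impI)
    fix k assume k: "a < k" "k \<le> S" "k \<notin> knotset p0 S"
    then have "\<exists>j. Suc j < length knot_list \<and> a \<le> knot_list ! j
        \<and> knot_list ! j < k \<and> k < knot_list ! Suc j"
      using assms by (intro sorted_nth_gap_ex[where b="S+1"] sorted_knot_list) (unfold set_knot_list, auto)
    then obtain j where j: "Suc j < length knot_list" "a \<le> sknot p0 S j"
      "sknot p0 S j < k" "k < sknot p0 S (Suc j)"
      unfolding sknot_nth by blast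
    then have "j \<le> card (knotset p0 S)" by (simp add: length_knot_list)
    with j L show "0 \<le> dd g k" by (auto simp: convex_between_def)
  qed
next
  assume R: ?R
  show ?L unfolding convex_between_def
  proof (intro allI impI)
    fix j k
    assume j: "j \<le> card (knotset p0 S)" "a \<le> sknot p0 S j"
      and k: "sknot p0 S j < k \<and> k < sknot p0 S (Suc j)"
    have len: "Suc j < length knot_list" unfolding length_knot_list using j by simp
    have nk: "k \<notin> set knot_list"
      using sorted_nth_gap[OF sorted_knot_list len] k unfolding sknot_nth by blast
    have "knot_list ! Suc j \<in> set knot_list" using len by (rule nth_mem)
    then have "sknot p0 S (Suc j) \<le> S + 1"
      unfolding sknot_nth set_knot_list using knotset_subset by fastforce
    with nk k j R show "0 \<le> dd g k" unfolding set_knot_list by auto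
  qed
qed

lemma CK_iff: "g \<in> CK p0 S \<longleftrightarrow> (\<forall>k>S+1. g k = 0) \<and>
    (\<forall>k. 0 < k \<longrightarrow> k \<le> S \<longrightarrow> k \<notin> knotset p0 S \<longrightarrow> 0 \<le> dd g k)"
  using convex_pieces_iff[of 0 g] by (simp add: CK_def)

lemma CKge_iff:
  assumes "s \<in> knotset p0 S"
  shows "g \<in> CKge p0 S s \<longleftrightarrow> (\<forall>k. k \<notin> {s..S+1} \<longrightarrow> g k = 0) \<and>
    (\<forall>k. s < k \<longrightarrow> k \<le> S \<longrightarrow> k \<notin> knotset p0 S \<longrightarrow> 0 \<le> dd g k)"
  using convex_pieces_iff[of s g] assms by (simp add: CKge_def)

lemma dd_add: "dd (\<lambda>k. f k + g k) k = dd f k + dd g k"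
  by (simp add: dd_def algebra_simps)

lemma dd_diff: "dd (\<lambda>k. f k - g k) k = dd f k - dd g k"
  by (simp add: dd_def algebra_simps)

lemma dd_scale: "dd (\<lambda>k. c * g k) k = c * dd g k"
  by (simp add: dd_def algebra_simps)

lemma continuous_on_dd: "continuous_on A (\<lambda>g. dd g k)"
  unfolding dd_def
  by (intro continuous_intros) (auto intro: continuous_on_product_coordinates continuous_on_subset)

lemma closed_convex_vectors:
  "closed {g. (\<forall>k. P k \<longrightarrow> g k = (0::real)) \<and> (\<forall>k. Q k \<longrightarrow> 0 \<le> dd g k)}"
  by (intro closed_Collect_conj closed_Collect_all closed_Collect_imp closed_Collect_eq
      closed_Collect_le continuous_on_dd) 
     (auto intro: continuous_on_product_coordinates continuous_on_subset)

lemma finite_cone_CK: "finite_cone {0..S+1} (CK p0 S)"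
proof
  have "CK p0 S = {g. (\<forall>k. S + 1 < k \<longrightarrow> g k = 0) \<and>
      (\<forall>k. 0 < k \<and> k \<le> S \<and> k \<notin> knotset p0 S \<longrightarrow> 0 \<le> dd g k)}"
    by (auto simp: CK_iff)
  then show "closed (CK p0 S)" by (simp only: closed_convex_vectors)
qed (auto simp: CK_iff dd_add dd_scale, auto simp: dd_def)

lemma finite_cone_CKge:
  assumes "s \<in> knotset p0 S"
  shows "finite_cone {s..S+1} (CKge p0 S s)"
proof
  have "CKge p0 S s = {g. (\<forall>k. k \<notin> {s..S+1} \<longrightarrow> g k = 0) \<and>
      (\<forall>k. s < k \<and> k \<le> S \<and> k \<notin> knotset p0 S \<longrightarrow> 0 \<le> dd g k)}"
    by (auto simp: CKge_iff[OF assms])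
  then show "closed (CKge p0 S s)" by (simp only: closed_convex_vectors)
qed (auto simp: CKge_iff[OF assms] dd_add dd_scale, auto simp: dd_def)

interpretation full: finite_cone "{0..S+1}" "CK p0 S"
  by (rule finite_cone_CK)

lemma Phi_eq_obj: "Phi S = full.obj"
  by (intro ext) (simp only: Phi_def full.obj_def)

lemma ghat_eq_proj: "ghat p0 S = full.proj"
  by (intro ext) (simp only: ghat_def full.proj_def Phi_eq_obj)

lemmas ghat_in = full.proj_in[folded ghat_eq_proj]
  and ghat_test = full.proj_test[folded ghat_eq_proj]
  and ghat_self = full.proj_self[folded ghat_eq_proj]
  and ghat_norm_le = full.proj_norm_le[folded ghat_eq_proj]
  and continuous_on_ghat = full.continuous_on_proj[folded ghat_eq_proj]

lemma ghat_diff_bound: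
  assumes "h \<in> CK p0 S"
  shows "(\<Sum>k\<in>{0..S+1}. (ghat p0 S w k - w k)\<^sup>2) + (\<Sum>k\<in>{0..S+1}. (h k - ghat p0 S w k)\<^sup>2)
      \<le> (\<Sum>k\<in>{0..S+1}. (h k - w k)\<^sup>2)"
  using full.obj_diff_bound[OF full.is_proj_proj assms, of w]
  unfolding ghat_eq_proj full.obj_def by linarith

text \<open>The unit vector at \<open>S + 1\<close> is an admissible test: it has second difference
  one at \<open>S\<close>, and the point \<open>S + 1\<close> carries no constraint. The sign is
  what convexity of the estimator at \<open>S + 2\<close> rests on.\<close>

lemma ghat_last_nonneg: 
  assumes "w (S+1) = 0"
  shows "0 \<le> ghat p0 S w (S+1)"
proof -
  have "(\<lambda>k. if k = S + 1 then 1 else 0) \<in> CK p0 S"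
    by (auto simp: CK_iff dd_def)
  from ghat_test[OF this, of w] show ?thesis
    using assms by (simp add: if_distrib cong: if_cong)
qed

text \<open>Constants of either sign belong to the cone, so the residual is orthogonal to
  them.\<close>

lemma ghat_sum: "(\<Sum>k\<in>{0..S+1}. ghat p0 S w k) = (\<Sum>k\<in>{0..S+1}. w k)"
proof -
  have c: "(\<lambda>k. if k \<le> S + 1 then c else 0) \<in> CK p0 S" for c
    by (auto simp: CK_iff dd_def)
  have "0 \<le> (\<Sum>k\<in>{0..S+1}. (ghat p0 S w k - w k) * c)" for c
  proof -
    have "0 \<le> (\<Sum>k\<in>{0..S+1}. (ghat p0 S w k - w k) * (if k \<le> S + 1 then c else 0))"
      by (rule ghat_test[OF c])
    also have "\<dots> = (\<Sum>k\<in>{0..S+1}. (ghat p0 S w k - w k) * c)"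
      by (intro sum.cong) auto
    finally show ?thesis .
  qed
  from this[of 1] this[of "-1"] show ?thesis by (simp add: sum_negf sum_subtractf)
qed

section \<open>Comparison of the full projection with the tail projection at a knot\<close>

context
  fixes s :: nat
  assumes s: "s \<in> knotset p0 S"
begin

interpretation tail: finite_cone "{s..S+1}" "CKge p0 S s"
  by (rule finite_cone_CKge[OF s])

lemma Phi_ge_eq_obj: "Phi_ge S s = tail.obj"
  by (intro ext) (simp only: Phi_ge_def tail.obj_def)

lemma gmin_ge_eq_proj: "gmin_ge p0 S s = tail.proj"
  by (intro ext) (simp only: gmin_ge_def tail.proj_def Phi_ge_eq_obj)

lemma ex1_gmin_ge:
  "\<exists>!g. g \<in> CKge p0 S s \<and> (\<forall>h\<in>CKge p0 S s. Phi_ge S s w g \<le> Phi_ge S s w h)"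
  unfolding Phi_ge_eq_obj tail.is_proj_iff[symmetric] by (rule tail.ex1_proj)

text \<open>For the bridge increments this is the difference between \<open>Ghat\<close> at
  \<open>s - 1\<close> and the bridge at the distribution function of \<open>s - 1\<close>, because
  those increments telescope.\<close>

definition defect :: "(nat \<Rightarrow> real) \<Rightarrow> real" where
  "defect w = (\<Sum>k<s. ghat p0 S w k - w k)"

definition ghat_tail :: "(nat \<Rightarrow> real) \<Rightarrow> nat \<Rightarrow> real" where
  "ghat_tail w k = (if k \<in> {s..S+1} then ghat p0 S w k else 0)"

lemma s_bounds: "1 \<le> s" "s \<le> S"
  using s knotset_subset by auto

lemma split_sum: "(\<Sum>k\<in>{0..S+1}. f k) = (\<Sum>k<s. f k) + (\<Sum>k\<in>{s..S+1}. f k)" for f :: "nat \<Rightarrow> real"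
proof -
  have "{0..S+1} = {..<s} \<union> {s..S+1}" using s_bounds by auto
  then show ?thesis by (simp add: sum.union_disjoint ivl_disj_int)
qed

lemma sum_ghat_tail: "(\<Sum>k\<in>{s..S+1}. ghat_tail w k) = (\<Sum>k\<in>{s..S+1}. w k) - defect w"
proof -
  have "(\<Sum>k\<in>{s..S+1}. ghat_tail w k) = (\<Sum>k\<in>{s..S+1}. ghat p0 S w k)"
    by (intro sum.cong) (auto simp: ghat_tail_def)
  with ghat_sum[of w] show ?thesis
    unfolding split_sum defect_def by (simp add: sum_subtractf)
qed

text \<open>Constants on \<open>{s..S+1}\<close>, of either sign, lie in the tail cone. Set against
  \<open>sum_ghat_tail\<close>, this shows that the two tails can agree only if the defect
  vanishes.\<close>

lemma sum_gmin_ge: "(\<Sum>k\<in>{s..S+1}. gmin_ge p0 S s w k) = (\<Sum>k\<in>{s..S+1}. w k)"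
proof -
  have c: "(\<lambda>k. if k \<in> {s..S+1} then c else 0) \<in> CKge p0 S s" for c
    by (auto simp: CKge_iff[OF s] dd_def)
  have "0 \<le> (\<Sum>k\<in>{s..S+1}. (gmin_ge p0 S s w k - w k) * c)" for c
  proof -
    have "0 \<le> (\<Sum>k\<in>{s..S+1}. (gmin_ge p0 S s w k - w k) * (if k \<in> {s..S+1} then c else 0))"
      unfolding gmin_ge_eq_proj by (rule tail.proj_test[OF c])
    also have "\<dots> = (\<Sum>k\<in>{s..S+1}. (gmin_ge p0 S s w k - w k) * c)"
      by (intro sum.cong) auto
    finally show ?thesis .
  qed
  from this[of 1] this[of "-1"] show ?thesis by (simp add: sum_negf sum_subtractf)
qed

text \<open>Raising \<open>g\<close> by a constant on \<open>{s..S+1}\<close> increases the second difference at \<open>s - 1\<close>, and the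
  second difference at the knot \<open>s\<close> is unconstrained.\<close>

lemma defect_nonpos: "defect w \<le> 0"
proof -
  have "0 \<le> dd (\<lambda>k. if k \<in> {s..S+1} then 1 else 0) k" if "k \<le> S" "k \<noteq> s" for k
    using that unfolding dd_def by (cases "k < s") auto
  then have "(\<lambda>k. if k \<in> {s..S+1} then 1 else 0) \<in> CK p0 S"
    using s by (auto simp: CK_iff)
  from ghat_test[OF this, of w]
  moreover have "(\<Sum>k\<in>{s..S+1}. (ghat p0 S w k - w k) * (if k \<in> {s..S+1} then 1 else 0))
      = (\<Sum>k\<in>{s..S+1}. ghat p0 S w k - w k)"
    by (intro sum.cong) auto
  moreover have "(\<Sum>k<s. (ghat p0 S w k - w k) * (if k \<in> {s..S+1} then 1 else 0)) = 0"
    by (intro sum.neutral) auto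
  ultimately have "0 \<le> (\<Sum>k\<in>{s..S+1}. ghat p0 S w k - w k)"
    unfolding split_sum by linarith
  moreover have "(\<Sum>k\<in>{0..S+1}. ghat p0 S w k - w k) = 0"
    using ghat_sum by (simp add: sum_subtractf)
  ultimately show ?thesis unfolding split_sum defect_def by linarith
qed

text \<open>A tail vector extended to the left by its value at \<open>s\<close> lies in the full
  cone, as a negative second difference can appear only at the knot \<open>s\<close>. With zero
  defect the constant part contributes nothing to the pairing, so the variational conditions of the
  full projection restrict to those of the tail projection.\<close>

lemma ghat_tail_eq_gmin_ge:
  assumes D: "defect w = 0"
  shows "ghat_tail w = gmin_ge p0 S s w"
proof -
  define g where "g = ghat p0 S w"
  define ext where "ext h k = (if k < s then h s else h k)" for h :: "nat \<Rightarrow> real" and k :: nat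
  have D': "(\<Sum>k<s. g k - w k) = 0" using D by (simp add: defect_def g_def)
  have split_ext: "(\<Sum>k\<in>{0..S+1}. (g k - w k) * ext h k) = (\<Sum>k\<in>{s..S+1}. (g k - w k) * h k)" for h
  proof -
    have "(\<Sum>k<s. (g k - w k) * ext h k) = (\<Sum>k<s. g k - w k) * h s"
      by (simp add: ext_def sum_distrib_right)
    moreover have "(\<Sum>k\<in>{s..S+1}. (g k - w k) * ext h k) = (\<Sum>k\<in>{s..S+1}. (g k - w k) * h k)"
      by (intro sum.cong) (auto simp: ext_def)
    ultimately show ?thesis unfolding split_sum by (simp add: D')
  qed
  \<comment> \<open>At \<open>k = s - 1\<close> the right neighbour is \<open>h s\<close> itself, so
    the extension is flat there too; only \<open>k = s\<close> is exceptional.\<close>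
  have dd_ext: "dd (ext h) k = (if k < s then 0 else dd h k)" if "k \<noteq> s" "0 < k" for h k
    using that by (cases "Suc k = s") (auto simp: dd_def ext_def)
  have gC: "g \<in> CK p0 S" unfolding g_def by (rule ghat_in)
  have tail_in: "ghat_tail w \<in> CKge p0 S s"
  proof -
    have "dd (ghat_tail w) k = dd g k" if "s < k" "k \<le> S" for k
      using that by (auto simp: dd_def ghat_tail_def g_def)
    then show ?thesis using gC by (auto simp: CKge_iff[OF s] CK_iff ghat_tail_def)
  qed
  have test: "0 \<le> (\<Sum>k\<in>{s..S+1}. (g k - w k) * h k)" if "h \<in> CKge p0 S s" for h
  proof -
    have "ext h \<in> CK p0 S" unfolding CK_iff
    proof safe
      fix k assume "0 < k" "k \<le> S" "k \<notin> knotset p0 S"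
      then show "0 \<le> dd (ext h) k"
        using that s dd_ext[of k h] by (cases "k = s") (auto simp: CKge_iff[OF s])
    qed (use that s_bounds in \<open>auto simp: ext_def CKge_iff[OF s]\<close>)
    from ghat_test[OF this, of w] show ?thesis
      unfolding g_def[symmetric] split_ext .
  qed
  \<comment> \<open>The difference vanishes from \<open>s\<close> on and has the second differences
    of \<open>g\<close> to the left of \<open>s\<close>. Testing it bounds the tail pairing of the
    residual with \<open>g\<close> from above; the tail itself, as a test vector, gives the lower
    bound.\<close>
  have "(\<lambda>k. g k - ext g k) \<in> CK p0 S" unfolding CK_iff dd_diff
  proof safe
    fix k assume "0 < k" "k \<le> S" "k \<notin> knotset p0 S"
    then show "0 \<le> dd g k - dd (ext g) k"
      using gC s dd_ext[of k g] by (cases "k = s") (auto simp: CK_iff)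
  qed (use s_bounds in \<open>auto simp: ext_def\<close>)
  from ghat_test[OF this, of w]
  have "0 \<le> (\<Sum>k\<in>{0..S+1}. (g k - w k) * g k) - (\<Sum>k\<in>{0..S+1}. (g k - w k) * ext g k)"
    by (simp add: g_def right_diff_distrib sum_subtractf)
  then have "(\<Sum>k\<in>{s..S+1}. (g k - w k) * g k) \<le> 0"
    unfolding split_ext using ghat_self[of w] by (simp add: g_def)
  moreover have tail_sum: "(\<Sum>k\<in>{s..S+1}. (ghat_tail w k - w k) * ghat_tail w k)
      = (\<Sum>k\<in>{s..S+1}. (g k - w k) * g k)"
      "(\<Sum>k\<in>{s..S+1}. (ghat_tail w k - w k) * h k) = (\<Sum>k\<in>{s..S+1}. (g k - w k) * h k)" for h
    by (intro sum.cong; auto simp: ghat_tail_def g_def)+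
  ultimately have "(\<Sum>k\<in>{s..S+1}. (ghat_tail w k - w k) * ghat_tail w k) = 0"
    using test[OF tail_in] tail_sum(2)[of "ghat_tail w"] by linarith
  then have "tail.is_proj w (ghat_tail w)"
    unfolding tail.is_proj_def tail_sum(2) using test tail_in tail_sum(2) by simp
  then show ?thesis unfolding gmin_ge_eq_proj by (rule tail.proj_eqI[symmetric])
qed

lemma ghat_tail_eq_gmin_ge_iff: "ghat_tail w = gmin_ge p0 S s w \<longleftrightarrow> defect w = 0"
proof
  assume "ghat_tail w = gmin_ge p0 S s w"
  with sum_gmin_ge[of w] have "(\<Sum>k\<in>{s..S+1}. ghat_tail w k) = (\<Sum>k\<in>{s..S+1}. w k)"
    by (simp only:)
  with sum_ghat_tail[of w] show "defect w = 0" by linarith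
qed (rule ghat_tail_eq_gmin_ge)

lemma gmin_ge_support: "k \<notin> {s..S+1} \<Longrightarrow> gmin_ge p0 S s w k = 0"
  unfolding gmin_ge_eq_proj using tail.support[OF tail.proj_in] .

lemma gmin_ge_agrees_ghat_iff:
  "(\<forall>k\<in>{s..S+1}. gmin_ge p0 S s w k = ghat p0 S w k) \<longleftrightarrow> defect w = 0"
  unfolding ghat_tail_eq_gmin_ge_iff[symmetric]
  using gmin_ge_support by (auto simp: ghat_tail_def fun_eq_iff)

lemma continuous_on_gmin_ge: "continuous_on UNIV (gmin_ge p0 S s)"
  unfolding gmin_ge_eq_proj by (rule tail.continuous_on_proj)

lemma continuous_on_ghat_coord: "continuous_on UNIV (\<lambda>w. ghat p0 S w k)"
  using continuous_on_ghat by (rule continuous_on_product_then_coordinatewise)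

lemma continuous_on_ghat_tail: "continuous_on UNIV ghat_tail"
proof (rule continuous_on_coordinatewise_then_product)
  show "continuous_on UNIV (\<lambda>w. ghat_tail w k)" for k
    unfolding ghat_tail_def using continuous_on_ghat_coord by (cases "k \<in> {s..S+1}") auto
qed

lemma continuous_on_defect: "continuous_on UNIV defect"
  unfolding defect_def
  by (intro continuous_intros continuous_on_ghat_coord) (auto intro: continuous_on_product_coordinates)

end

end

section \<open>Local form of the convex least squares estimator\<close>

lemma suminf_split_at:
  fixes f :: "nat \<Rightarrow> real"
  assumes "summable f"
  shows "(\<Sum>j. f j) = (\<Sum>j\<in>{0..S+1}. f j) + (\<Sum>j. f (j + (S + 2)))"
proof -
  have "{0..S+1} = {..<S+2}" by auto
  then show ?thesis using suminf_split_initial_segment[OF assms, of "S+2"] by simp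
qed

text \<open>The quadratic gain yields minimality and uniqueness at once, and the \<open>THE\<close>
  in \<open>hat_p\<close> asks for both.\<close>

lemma hat_p_eqI:
  assumes p: "p \<in> convex_seqs"
    and bound: "\<And>p'. p' \<in> convex_seqs \<Longrightarrow> summable (\<lambda>j. (p' j - p j)\<^sup>2) \<and>
      lsq_obj q p + (1/2) * (\<Sum>j. (p' j - p j)\<^sup>2) \<le> lsq_obj q p'"
  shows "hat_p q = p"
  unfolding hat_p_def
proof (rule the_equality)
  have "lsq_obj q p \<le> lsq_obj q p'" if "p' \<in> convex_seqs" for p'
    using bound[OF that] suminf_nonneg[of "\<lambda>j. (p' j - p j)\<^sup>2"] by simp
  with p show "p \<in> convex_seqs \<and> (\<forall>p'\<in>convex_seqs. lsq_obj q p \<le> lsq_obj q p')" by blast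
next
  fix p' assume p': "p' \<in> convex_seqs \<and> (\<forall>h\<in>convex_seqs. lsq_obj q p' \<le> lsq_obj q h)"
  then have sm: "summable (\<lambda>j. (p' j - p j)\<^sup>2)" and le: "(\<Sum>j. (p' j - p j)\<^sup>2) \<le> 0"
    using bound[of p'] p by force+
  then have "(\<Sum>j. (p' j - p j)\<^sup>2) = 0" using suminf_nonneg[OF sm] by simp
  then have "\<forall>j. (p' j - p j)\<^sup>2 = 0" using suminf_eq_zero_iff[OF sm] by simp
  then show "p' = p" by (auto simp: fun_eq_iff)
qed

text \<open>The perturbation \<open>g\<close> has entries of size at most \<open>d\<close>, hence
  second differences of size at most \<open>4 * d\<close>, so constraints that hold for
  \<open>p0\<close> with margin \<open>4 * d\<close> survive. At the other points up to
  \<open>S\<close> the sequence \<open>p0\<close> is locally linear and convexity is inherited from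
  the cone. The factor \<open>r\<close>, later the square root of \<open>n\<close>, is harmless
  because cones are scale invariant.\<close>

lemma hat_p_eq_ghat:
  assumes cvx: "convex_seq p0" and supp: "{k. p0 k \<noteq> 0} = {0..S}"
    and d: "\<And>k. k \<in> knotset p0 S \<Longrightarrow> 4 * d \<le> dd p0 k" "4 * d \<le> p0 S"
    and q0: "\<And>k. S < k \<Longrightarrow> q k = 0" and r: "0 < r"
    and small: "(\<Sum>k\<in>{0..S+1}. (q k - p0 k)\<^sup>2) \<le> d\<^sup>2" and d0: "0 \<le> d"
    and w: "\<And>k. k \<le> S + 1 \<Longrightarrow> w k = r * (q k - p0 k)"
  shows "hat_p q = (\<lambda>k. p0 k + ghat p0 S w k / r)"
proof -
  define g where "g k = ghat p0 S w k / r" for k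
  define p where "p k = p0 k + g k" for k
  have p0_0: "p0 k = 0" if "S < k" for k
    using supp that by (metis (mono_tags, lifting) atLeastAtMost_iff mem_Collect_eq not_le)
  have gC: "g \<in> CK p0 S"
    using finite_cone.scale[OF finite_cone_CK ghat_in, of "1/r"] r by (simp add: g_def[abs_def])
  have g0: "g k = 0" if "S + 1 < k" for k using gC that by (simp add: CK_iff)
  have w_last: "w (S+1) = 0" using w[of "S+1"] q0 p0_0 by simp
  have g_last: "0 \<le> g (S+1)" using ghat_last_nonneg[of w S] w_last r by (simp add: g_def)
  have g_small: "\<bar>g k\<bar> \<le> d" for k
  proof (cases "k \<le> S + 1")
    case True
    have "(ghat p0 S w k)\<^sup>2 \<le> (\<Sum>k\<in>{0..S+1}. (ghat p0 S w k)\<^sup>2)"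
      using True by (intro member_le_sum) auto
    also have "\<dots> \<le> (\<Sum>k\<in>{0..S+1}. (w k)\<^sup>2)" by (rule ghat_norm_le)
    also have "\<dots> = (\<Sum>k\<in>{0..S+1}. r\<^sup>2 * (q k - p0 k)\<^sup>2)"
      by (intro sum.cong) (auto simp: w power_mult_distrib)
    also have "\<dots> \<le> r\<^sup>2 * d\<^sup>2"
      unfolding sum_distrib_left[symmetric] using small by (intro mult_left_mono) auto
    finally have "(g k)\<^sup>2 \<le> d\<^sup>2" using r by (simp add: g_def power_divide field_simps)
    then show ?thesis using d0 by (simp add: abs_le_square_iff[symmetric])
  qed (use g0 d0 in simp)
  have dd_g_lb: "- (4 * d) \<le> dd g k" for k
    using g_small[of "Suc k"] g_small[of k] g_small[of "k - 1"] unfolding dd_def by linarith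
  have dd_p: "dd p k = dd p0 k + dd g k" for k unfolding p_def[abs_def] by (rule dd_add)
  have "0 \<le> dd p k" if "1 \<le> k" for k
  proof -
    have nn: "0 \<le> dd p0 k" using cvx that by (simp add: convex_seq_def)
    consider "k \<in> knotset p0 S" | "k \<le> S" "k \<notin> knotset p0 S" | "k = S + 1" | "k = S + 2" | "S + 2 < k"
      by linarith
    then show ?thesis
    proof cases
      case 1 then show ?thesis using d(1)[of k] dd_g_lb[of k] dd_p by simp
    next
      case 2 then show ?thesis using gC that nn dd_p by (simp add: CK_iff)
    next
      \<comment> \<open>The point \<open>S + 1\<close> is outside \<open>knotset\<close>, yet
        \<open>p0\<close> bends there by \<open>p0 S\<close>, which is why \<open>p0 S\<close>
        enters the margin.\<close>
      case 3
      then have "dd p0 k = p0 S" using p0_0 by (simp add: dd_def)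
      then show ?thesis using d(2) dd_g_lb[of k] dd_p by simp
    next
      \<comment> \<open>At \<open>S + 2\<close> the only contribution of \<open>g\<close> is its
        last entry, nonnegative by \<open>ghat_last_nonneg\<close>.\<close>
      case 4
      then have "dd g k = g (S + 1)" using g0 by (simp add: dd_def)
      then show ?thesis using g_last nn dd_p by simp
    next
      case 5
      then have "dd g k = 0" using g0 by (simp add: dd_def)
      then show ?thesis using nn dd_p by simp
    qed
  qed
  then have p_cvx: "convex_seq p" by (simp add: convex_seq_def)
  have p_tail: "p k = 0" if "S + 1 < k" for k using that g0 p0_0 by (simp add: p_def)
  have "summable (\<lambda>k. (p k)\<^sup>2)"
    by (rule summable_finite[of "{..S+1}"]) (simp_all add: p_tail)
  with p_cvx have p_in: "p \<in> convex_seqs" by (simp add: convex_seqs_def)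
  have "hat_p q = p"
  proof (rule hat_p_eqI[OF p_in])
    fix p' assume p': "p' \<in> convex_seqs"
    \<comment> \<open>Rescaled deviations of a competitor from \<open>p0\<close> form a cone vector:
      off the knots \<open>p0\<close> has zero second difference, so \<open>h\<close> inherits
      convexity from \<open>p'\<close>. The cut past \<open>S + 1\<close> is invisible to second
      differences up to \<open>S\<close>.\<close>
    define h where "h k = (if k \<le> S + 1 then r * (p' k - p0 k) else 0)" for k
    have "h \<in> CK p0 S" unfolding CK_iff
    proof (intro conjI allI impI)
      fix k assume k: "0 < k" "k \<le> S" "k \<notin> knotset p0 S"
      then have "dd p0 k = 0"
        using cvx by (auto simp: convex_seq_def knotset_def knot_def intro: order_antisym)
      moreover have "dd h k = r * (dd p' k - dd p0 k)"
        using k by (cases k) (simp_all add: dd_def h_def algebra_simps)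
      moreover have "0 \<le> dd p' k" using p' k by (simp add: convex_seqs_def convex_seq_def)
      ultimately show "0 \<le> dd h k" using r by simp
    qed (simp add: h_def)
    note diff_bound = ghat_diff_bound[OF this, of w]
    have "(\<Sum>k\<in>{0..S+1}. (r * (p k - q k))\<^sup>2) + (\<Sum>k\<in>{0..S+1}. (r * (p' k - p k))\<^sup>2)
        \<le> (\<Sum>k\<in>{0..S+1}. (r * (p' k - q k))\<^sup>2)"
    proof -
      have "ghat p0 S w k - w k = r * (p k - q k)" "h k - ghat p0 S w k = r * (p' k - p k)"
          "h k - w k = r * (p' k - q k)" if "k \<in> {0..S+1}" for k
        using that r by (auto simp: w p_def g_def h_def field_simps)
      then have "(\<Sum>k\<in>{0..S+1}. (ghat p0 S w k - w k)\<^sup>2) = (\<Sum>k\<in>{0..S+1}. (r * (p k - q k))\<^sup>2)"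
          "(\<Sum>k\<in>{0..S+1}. (h k - ghat p0 S w k)\<^sup>2) = (\<Sum>k\<in>{0..S+1}. (r * (p' k - p k))\<^sup>2)"
          "(\<Sum>k\<in>{0..S+1}. (h k - w k)\<^sup>2) = (\<Sum>k\<in>{0..S+1}. (r * (p' k - q k))\<^sup>2)"
        by (simp_all only: cong: sum.cong)
      with diff_bound show ?thesis by (simp only:)
    qed
    then have "r\<^sup>2 * ((\<Sum>k\<in>{0..S+1}. (p k - q k)\<^sup>2) + (\<Sum>k\<in>{0..S+1}. (p' k - p k)\<^sup>2))
        \<le> r\<^sup>2 * (\<Sum>k\<in>{0..S+1}. (p' k - q k)\<^sup>2)"
      by (simp only: power_mult_distrib sum_distrib_left[symmetric] distrib_left)
    then have main: "(\<Sum>k\<in>{0..S+1}. (q k - p k)\<^sup>2) + (\<Sum>k\<in>{0..S+1}. (p' k - p k)\<^sup>2)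
        \<le> (\<Sum>k\<in>{0..S+1}. (q k - p' k)\<^sup>2)"
      using r by (simp add: power2_commute[of "q _"] del: sum.cl_ivl_Suc)
    have sm': "summable (\<lambda>j. (p' (j + (S + 2)))\<^sup>2)"
      using p' by (intro summable_ignore_initial_segment[of "\<lambda>j. (p' j)\<^sup>2"]) (simp add: convex_seqs_def)
    \<comment> \<open>Beyond \<open>S + 1\<close> both \<open>q\<close> and \<open>p\<close> vanish,
      so a competitor contributes the same tail to its distance from either, and the finite
      inequality extends to the series.\<close>
    have tails: "q (j + (S + 2)) = 0" "p (j + (S + 2)) = 0" for j
      using q0 p_tail by simp_all
    have "summable (\<lambda>j. (p' (j + (S + 2)) - p (j + (S + 2)))\<^sup>2)"
      "summable (\<lambda>j. (q (j + (S + 2)) - p' (j + (S + 2)))\<^sup>2)"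
      using sm' unfolding tails by simp_all
    then have sm: "summable (\<lambda>j. (p' j - p j)\<^sup>2)" "summable (\<lambda>j. (q j - p' j)\<^sup>2)"
      by (simp_all only: summable_iff_shift[of "\<lambda>j. (p' j - p j)\<^sup>2"]
          summable_iff_shift[of "\<lambda>j. (q j - p' j)\<^sup>2"])
    have smq: "summable (\<lambda>j. (q j - p j)\<^sup>2)"
      by (rule summable_finite[of "{..S+1}"]) (simp_all add: q0 p_tail)
    have "(\<Sum>j. (q j - p j)\<^sup>2) + (\<Sum>j. (p' j - p j)\<^sup>2) \<le> (\<Sum>j. (q j - p' j)\<^sup>2)"
      unfolding suminf_split_at[OF smq, of S] suminf_split_at[OF sm(1), of S]
        suminf_split_at[OF sm(2), of S] tails
      using main by simp
    with sm(1) show "summable (\<lambda>j. (p' j - p j)\<^sup>2) \<and>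
        lsq_obj q p + (1/2) * (\<Sum>j. (p' j - p j)\<^sup>2) \<le> lsq_obj q p'"
      by (simp add: lsq_obj_def)
  qed
  then show ?thesis by (simp add: p_def g_def fun_eq_iff)
qed

text \<open>The margin is a quarter of the least of finitely many positive numbers:
  \<open>p0 S\<close> and the second differences at the knots.\<close>

lemma hat_p_local_margin:
  assumes "convex_seq p0" "{k. p0 k \<noteq> 0} = {0..S}" "\<forall>k. 0 \<le> p0 k"
  obtains d where "0 < d" "\<And>k. k \<in> knotset p0 S \<Longrightarrow> 4 * d \<le> dd p0 k" "4 * d \<le> p0 S"
proof
  define A where "A = insert (p0 S) (dd p0 ` knotset p0 S)"
  have A: "finite A" "A \<noteq> {}" by (simp_all add: A_def)
  have "S \<in> {k. p0 k \<noteq> 0}" unfolding assms(2) by simp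
  then have "p0 S \<noteq> 0" by simp
  then have "0 < p0 S" using assms(3) by (metis order_le_less)
  then have "\<forall>x\<in>A. 0 < x" by (auto simp: A_def knotset_def knot_def)
  then show "0 < Min A / 4" using A by simp
  show "4 * (Min A / 4) \<le> dd p0 k" if "k \<in> knotset p0 S" for k using that A by (simp add: A_def)
  show "4 * (Min A / 4) \<le> p0 S" using A by (simp add: A_def)
qed

section \<open>Weak convergence from trigonometric test functions\<close>

text \<open>The span of the waves whose expectations are governed by characteristic functions. The
  phase lets one generator serve for sine and cosine.\<close>

inductive_set trig_polys :: "nat \<Rightarrow> ((nat \<Rightarrow> real) \<Rightarrow> real) set" for d where
  wave: "(\<lambda>x. cos ((\<Sum>k<d. t k * x k) + \<phi>)) \<in> trig_polys d"
| add: "f \<in> trig_polys d \<Longrightarrow> g \<in> trig_polys d \<Longrightarrow> (\<lambda>x. f x + g x) \<in> trig_polys d"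
| scale: "f \<in> trig_polys d \<Longrightarrow> (\<lambda>x. c * f x) \<in> trig_polys d"

lemma trig_polys_const: "(\<lambda>_. c) \<in> trig_polys d"
  using trig_polys.scale[OF trig_polys.wave[of "\<lambda>_. 0" d 0], of c] by simp

lemma trig_polys_sin:
  assumes "k < d"
  shows "(\<lambda>x. sin (c * x k)) \<in> trig_polys d"
proof -
  have "(\<lambda>x. cos ((\<Sum>j<d. (if j = k then c else 0) * x j) + (- pi / 2))) \<in> trig_polys d"
    by (rule trig_polys.wave)
  also have "(\<lambda>x. cos ((\<Sum>j<d. (if j = k then c else 0) * x j) + (- pi / 2))) = (\<lambda>x. sin (c * x k))"
    using assms by (simp add: if_distrib[of "\<lambda>c. c * _"] cos_diff cong: if_cong)
  finally show ?thesis .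
qed

text \<open>The product-to-sum formula for cosines; it makes the span an algebra, as
  Stone-Weierstrass demands.\<close>

lemma trig_polys_wave_mult:
  assumes "g \<in> trig_polys d"
  shows "(\<lambda>x. cos ((\<Sum>k<d. t k * x k) + \<phi>) * g x) \<in> trig_polys d"
  using assms
proof induction
  case (wave u \<psi>)
  have "(\<lambda>x. (1/2) * (cos ((\<Sum>k<d. (t k - u k) * x k) + (\<phi> - \<psi>))
      + cos ((\<Sum>k<d. (t k + u k) * x k) + (\<phi> + \<psi>)))) \<in> trig_polys d"
    by (intro trig_polys.intros)
  also have "(\<lambda>x. (1/2) * (cos ((\<Sum>k<d. (t k - u k) * x k) + (\<phi> - \<psi>))
      + cos ((\<Sum>k<d. (t k + u k) * x k) + (\<phi> + \<psi>))))
    = (\<lambda>x. cos ((\<Sum>k<d. t k * x k) + \<phi>) * cos ((\<Sum>k<d. u k * x k) + \<psi>))"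
    by (intro ext, subst cos_times_cos)
       (simp add: left_diff_distrib distrib_right sum_subtractf sum.distrib algebra_simps)
  finally show ?case .
next
  case (add f g)
  from trig_polys.add[OF add.IH] show ?case by (simp add: distrib_left)
next
  case (scale f c)
  from trig_polys.scale[OF scale.IH, of c] show ?case by (simp add: mult_ac)
qed

lemma trig_polys_mult:
  assumes "f \<in> trig_polys d" "g \<in> trig_polys d"
  shows "(\<lambda>x. f x * g x) \<in> trig_polys d"
  using assms(1)
proof induction
  case (wave t \<phi>)
  show ?case by (rule trig_polys_wave_mult[OF assms(2)])
next
  case (add f1 f2)
  from trig_polys.add[OF add.IH] show ?case by (simp add: distrib_right)
next
  case (scale f c)
  from trig_polys.scale[OF scale.IH, of c] show ?case by (simp add: mult_ac)
qed

definition cube :: "nat \<Rightarrow> real \<Rightarrow> (nat \<Rightarrow> real) set" where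
  "cube d L = {x. \<forall>k. x k \<in> (if k < d then {- L..L} else {0})}"

lemma cube_iff: "x \<in> cube d L \<longleftrightarrow> (\<forall>k<d. \<bar>x k\<bar> \<le> L) \<and> (\<forall>k\<ge>d. x k = 0)"
  by (simp add: cube_def abs_le_iff) (metis linorder_not_less minus_le_iff)

lemma compact_cube: "compact (cube d L)"
  unfolding cube_def by (rule compact_box_fun) auto

text \<open>On the cube, \<open>f\<close> is a continuous function of the sines \<open>sin (\<pi> x\<^sub>k / 2 L)\<close>, and polynomials in these
  are trigonometric polynomials; their periodicity yields the global bound.\<close>

lemma trig_polys_approx:
  fixes f :: "(nat \<Rightarrow> real) \<Rightarrow> real"
  assumes f: "continuous_on UNIV f" "\<And>x. \<bar>f x\<bar> \<le> B" and L: "0 < L" and e: "0 < e"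
  obtains g where "g \<in> trig_polys d" "\<And>x. x \<in> cube d L \<Longrightarrow> \<bar>f x - g x\<bar> < e"
    "\<And>x. \<bar>g x\<bar> \<le> B + e"
proof -
  define c where "c = pi / (2 * L)"
  have c: "0 < c" using L by (simp add: c_def)
  define F where "F z = f (\<lambda>k. arcsin (z k) / c)" for z :: "nat \<Rightarrow> real"
  define sines where "sines x k = (if k < d then sin (c * x k) else 0)" for x and k :: nat
  define R where "R = {P. continuous_on (cube d 1) P \<and> (\<lambda>x. P (sines x)) \<in> trig_polys d}"
  have coord: "continuous_on A (\<lambda>z :: nat \<Rightarrow> real. z k)" for A k
    by (rule continuous_on_subset[OF continuous_on_product_coordinates]) simp
  interpret function_ring_on R "cube d 1"
  proof
    fix x y assume xy: "x \<in> cube d 1" "y \<in> cube d 1" "x \<noteq> y"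
    then obtain k where k: "x k \<noteq> y k" by auto
    then have "k < d" using xy by (metis cube_iff linorder_not_less)
    then have "(\<lambda>z. z k) \<in> R" using trig_polys_sin[of k d c] coord by (simp add: R_def sines_def)
    then show "\<exists>f\<in>R. f x \<noteq> f y" by (rule bexI[of _ "\<lambda>z. z k", rotated]) (rule k)
  qed (auto simp: R_def compact_cube trig_polys_const trig_polys.add trig_polys_mult
        continuous_on_add continuous_on_mult)
  have "continuous_on (cube d 1) (\<lambda>z k. arcsin (z k) / c)"
  proof (rule continuous_on_coordinatewise_then_product)
    fix k
    have "\<forall>z\<in>cube d 1. - 1 \<le> z k \<and> z k \<le> 1"
    proof
      fix z assume "z \<in> cube d 1"
      then have "\<bar>z k\<bar> \<le> 1" by (cases "k < d") (simp_all add: cube_iff)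
      then show "- 1 \<le> z k \<and> z k \<le> 1" by linarith
    qed
    then show "continuous_on (cube d 1) (\<lambda>z. arcsin (z k) / c)"
      using c by (intro continuous_intros coord) auto
  qed
  then have "continuous_on (cube d 1) F"
    unfolding F_def by (rule continuous_on_compose2[OF f(1)]) simp
  from Stone_Weierstrass_basic[OF this e] obtain P
    where P: "P \<in> R" "\<And>z. z \<in> cube d 1 \<Longrightarrow> \<bar>F z - P z\<bar> < e" by blast
  have sines_cube: "sines x \<in> cube d 1" for x by (simp add: cube_iff sines_def)
  show ?thesis
  proof
    show "(\<lambda>x. P (sines x)) \<in> trig_polys d" using P(1) by (simp add: R_def)
    show "\<bar>f x - P (sines x)\<bar> < e" if x: "x \<in> cube d L" for x
    proof -
      have "arcsin (sines x k) / c = x k" for k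
      proof (cases "k < d")
        case True
        then have xk: "- L \<le> x k" "x k \<le> L" using x by (fastforce simp: cube_iff abs_le_iff)+
        have "c * L = pi / 2" using L by (simp add: c_def)
        then have "- (pi / 2) \<le> c * x k" "c * x k \<le> pi / 2"
          using mult_left_mono[OF xk(1), of c] mult_left_mono[OF xk(2), of c] c by linarith+
        then show ?thesis using True c by (simp add: sines_def arcsin_sin)
      next
        case False
        then show ?thesis using x by (simp add: cube_iff sines_def)
      qed
      then have "F (sines x) = f x" by (simp add: F_def)
      with P(2)[OF sines_cube, of x] show ?thesis by simp
    qed
    show "\<bar>P (sines x)\<bar> \<le> B + e" for x
      using P(2)[OF sines_cube, of x] f(2)[of "\<lambda>k. arcsin (sines x k) / c"]
      unfolding F_def by linarith
  qed
qed

section \<open>Approximation of expectations and tightness\<close>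

lemma trig_polys_continuous:
  assumes "g \<in> trig_polys d"
  shows "continuous_on UNIV g"
  using assms
  by induction (intro continuous_intros continuous_on_product_coordinates; assumption)+

lemma (in prob_space) integrable_comp_bounded:
  fixes f :: "(nat \<Rightarrow> real) \<Rightarrow> real"
  assumes "continuous_on UNIV f" "\<And>x. \<bar>f x\<bar> \<le> B" "Z \<in> borel_measurable M"
  shows "integrable M (\<lambda>\<omega>. f (Z \<omega>))"
proof (rule integrable_const_bound[of _ B])
  have "f \<in> borel_measurable borel" using assms(1) by (rule borel_measurable_continuous_onI)
  then show "(\<lambda>\<omega>. f (Z \<omega>)) \<in> borel_measurable M" using assms(3) by measurable
qed (simp add: assms(2))

text \<open>On the event that \<open>Z\<close> stays in the cube the integrands differ by less than
  \<open>e\<close>; off it they differ by at most the sum of their global bounds.\<close>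

lemma (in prob_space) expectation_approx:
  fixes f g :: "(nat \<Rightarrow> real) \<Rightarrow> real"
  assumes f: "continuous_on UNIV f" "\<And>x. \<bar>f x\<bar> \<le> B"
    and g: "continuous_on UNIV g" "\<And>x. \<bar>g x\<bar> \<le> B + e" "\<And>x. x \<in> cube d L \<Longrightarrow> \<bar>f x - g x\<bar> < e"
    and Z: "Z \<in> borel_measurable M" and e: "0 \<le> e" and B: "0 \<le> B"
  shows "\<bar>(\<integral>\<omega>. f (Z \<omega>) \<partial>M) - (\<integral>\<omega>. g (Z \<omega>) \<partial>M)\<bar>
    \<le> e + (2 * B + e) * prob {\<omega>\<in>space M. Z \<omega> \<notin> cube d L}"
proof -
  define A where "A = {\<omega>\<in>space M. Z \<omega> \<notin> cube d L}"
  have [measurable]: "cube d L \<in> sets borel"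
    using compact_imp_closed[OF compact_cube] by (rule borel_closed)
  have A: "A \<in> sets M" unfolding A_def using Z by measurable
  have int: "integrable M (\<lambda>\<omega>. f (Z \<omega>))" "integrable M (\<lambda>\<omega>. g (Z \<omega>))"
    by (rule integrable_comp_bounded[OF f Z], rule integrable_comp_bounded[OF g(1,2) Z])
  have "\<bar>(\<integral>\<omega>. f (Z \<omega>) \<partial>M) - (\<integral>\<omega>. g (Z \<omega>) \<partial>M)\<bar> = \<bar>\<integral>\<omega>. f (Z \<omega>) - g (Z \<omega>) \<partial>M\<bar>"
    using int by simp
  also have "\<dots> \<le> (\<integral>\<omega>. \<bar>f (Z \<omega>) - g (Z \<omega>)\<bar> \<partial>M)"
    by (rule integral_abs_bound)
  also have "\<dots> \<le> (\<integral>\<omega>. e + (2 * B + e) * indicator A \<omega> \<partial>M)"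
  proof (rule integral_mono)
    fix \<omega> assume \<omega>: "\<omega> \<in> space M"
    show "\<bar>f (Z \<omega>) - g (Z \<omega>)\<bar> \<le> e + (2 * B + e) * indicator A \<omega>"
    proof (cases "\<omega> \<in> A")
      case True then show ?thesis using f(2)[of "Z \<omega>"] g(2)[of "Z \<omega>"] e by simp
    next
      case False then show ?thesis using g(3)[of "Z \<omega>"] \<omega> by (simp add: A_def)
    qed
  qed (use int A in \<open>auto intro!: integrable_add integrable_mult_right simp: emeasure_eq_measure\<close>)
  also have "\<dots> = e + (2 * B + e) * prob A"
    using A by (subst Bochner_Integration.integral_add) (auto simp: prob_space emeasure_eq_measure)
  finally show ?thesis by (simp add: A_def)
qed

text \<open>The events of leaving cubes of growing integer size decrease to the empty set, so
  continuity from above applies.\<close>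

lemma (in prob_space) single_tight:
  assumes Z: "Z \<in> borel_measurable M" "\<And>\<omega> k. \<omega> \<in> space M \<Longrightarrow> d \<le> k \<Longrightarrow> Z \<omega> k = 0" and e: "0 < e"
  shows "\<exists>L0. \<forall>L\<ge>L0. prob {\<omega>\<in>space M. Z \<omega> \<notin> cube d L} < e"
proof -
  define A where "A n = {\<omega>\<in>space M. Z \<omega> \<notin> cube d (real n)}" for n
  have [measurable]: "cube d L \<in> sets borel" for L
    using compact_imp_closed[OF compact_cube] by (rule borel_closed)
  have mono: "{\<omega>\<in>space M. Z \<omega> \<notin> cube d L'} \<subseteq> {\<omega>\<in>space M. Z \<omega> \<notin> cube d L}" if "L \<le> L'" for L L'
    using that by (auto simp: cube_iff intro: order_trans)
  have A: "A n \<in> sets M" for n unfolding A_def using Z(1) by measurable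
  have "\<omega> \<notin> (\<Inter>n. A n)" for \<omega>
  proof
    assume "\<omega> \<in> (\<Inter>n. A n)"
    then have *: "\<omega> \<in> A n" for n by blast
    obtain n where n: "(\<Sum>k<d. \<bar>Z \<omega> k\<bar>) \<le> real n" using real_arch_simple by blast
    have "\<bar>Z \<omega> k\<bar> \<le> real n" if "k < d" for k
      using member_le_sum[of k "{..<d}" "\<lambda>k. \<bar>Z \<omega> k\<bar>"] that n by simp
    then have "Z \<omega> \<in> cube d (real n)" using Z(2)[of \<omega>] *[of 0]
      by (simp add: cube_iff A_def)
    with *[of n] show False by (simp add: A_def)
  qed
  then have "(\<Inter>n. A n) = {}" by blast
  moreover have "(\<lambda>n. prob (A n)) \<longlonglongrightarrow> prob (\<Inter>n. A n)"
  proof (intro finite_Lim_measure_decseq)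
    show "decseq A" unfolding decseq_def A_def by (intro allI impI mono) simp
  qed (use A in auto)
  ultimately have "(\<lambda>n. prob (A n)) \<longlonglongrightarrow> 0" by simp
  then have "\<forall>\<^sub>F n in sequentially. prob (A n) < e" using e by (rule order_tendstoD)
  then obtain n where n: "prob (A n) < e" using eventually_sequentially by auto
  have "prob {\<omega>\<in>space M. Z \<omega> \<notin> cube d L} < e" if "real n \<le> L" for L
    using finite_measure_mono[OF mono[OF that] A[of n, unfolded A_def]] n by (simp add: A_def)
  then show ?thesis by blast
qed

text \<open>Convergence on waves extends to trigonometric polynomials by linearity. A bounded
  continuous function is close to such a polynomial on a large cube, and tightness makes the
  complement of the cube negligible.\<close>

lemma weak_convergence_trig:
  fixes Z :: "'b \<Rightarrow> nat \<Rightarrow> real" and Y :: "nat \<Rightarrow> 'a \<Rightarrow> nat \<Rightarrow> real"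
  assumes M: "prob_space M" and N: "prob_space N"
    and Y: "\<And>n. Y n \<in> borel_measurable M"
    and Z: "Z \<in> borel_measurable N" "\<And>\<omega> k. \<omega> \<in> space N \<Longrightarrow> d \<le> k \<Longrightarrow> Z \<omega> k = 0"
    and tight: "\<And>e. 0 < e \<Longrightarrow> \<exists>L0. \<forall>L\<ge>L0. \<forall>\<^sub>F n in sequentially.
       measure M {\<omega>\<in>space M. Y n \<omega> \<notin> cube d L} < e"
    and wave: "\<And>t \<phi>. (\<lambda>n. \<integral>\<omega>. cos ((\<Sum>k<d. t k * Y n \<omega> k) + \<phi>) \<partial>M)
       \<longlonglongrightarrow> (\<integral>\<omega>. cos ((\<Sum>k<d. t k * Z \<omega> k) + \<phi>) \<partial>N)"
  shows "conv_distr M Y N Z"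
  unfolding conv_distr_def
proof (intro allI impI)
  interpret M: prob_space M by (rule M)
  interpret N: prob_space N by (rule N)
  have trig_conv: "(\<exists>C. \<forall>x. \<bar>g x\<bar> \<le> C) \<and> (\<lambda>n. \<integral>\<omega>. g (Y n \<omega>) \<partial>M) \<longlonglongrightarrow> (\<integral>\<omega>. g (Z \<omega>) \<partial>N)"
    if "g \<in> trig_polys d" for g
    using that
  proof induction
    case (wave t \<phi>)
    show ?case using assms(7) by (intro conjI exI[of _ 1]) auto
  next
    case (add f g)
    then obtain C D where "\<forall>x. \<bar>f x\<bar> \<le> C" "\<forall>x. \<bar>g x\<bar> \<le> D" by blast
    then have *: "integrable M (\<lambda>\<omega>. f (Y n \<omega>))" "integrable M (\<lambda>\<omega>. g (Y n \<omega>))"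
      "integrable N (\<lambda>\<omega>. f (Z \<omega>))" "integrable N (\<lambda>\<omega>. g (Z \<omega>))" "\<forall>x. \<bar>f x + g x\<bar> \<le> C + D" for n
      using add.hyps[THEN trig_polys_continuous] Y Z(1)
        M.integrable_comp_bounded[of f C "Y n"] M.integrable_comp_bounded[of g D "Y n"]
        N.integrable_comp_bounded[of f C Z] N.integrable_comp_bounded[of g D Z]
      by (auto intro: abs_triangle_ineq[THEN order_trans] add_mono)
    then show ?case using add.IH by (auto intro!: tendsto_add)
  next
    case (scale f c)
    then obtain C where "\<forall>x. \<bar>f x\<bar> \<le> C" by blast
    then have "\<forall>x. \<bar>c * f x\<bar> \<le> \<bar>c\<bar> * C" by (simp add: abs_mult mult_left_mono)
    then show ?case using scale.IH by (auto intro!: tendsto_mult_left)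
  qed
  fix f :: "(nat \<Rightarrow> real) \<Rightarrow> real"
  assume "continuous_on UNIV f \<and> bounded (range f)"
  then obtain B where f: "continuous_on UNIV f" and B: "\<And>x. \<bar>f x\<bar> \<le> B"
    unfolding bounded_iff by auto
  have B0: "0 \<le> B" using B[of "\<lambda>_. 0"] by linarith
  show "(\<lambda>n. \<integral>\<omega>. f (Y n \<omega>) \<partial>M) \<longlonglongrightarrow> (\<integral>\<omega>. f (Z \<omega>) \<partial>N)"
  proof (rule LIMSEQ_I)
    fix r :: real assume r: "0 < r"
    \<comment> \<open>Three errors arise, for \<open>Y n\<close>, for \<open>Z\<close> and for the
      polynomial; this choice keeps each of the two approximation errors within
      \<open>r / 3\<close>.\<close>
    define e where "e = min 1 (r / (3 * (2 * B + 3)))"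
    have e: "0 < e" "e \<le> 1" "e \<le> r / (3 * (2 * B + 3))" using r B0 by (auto simp: e_def)
    have err: "e + (2 * B + e) * e \<le> r / 3" 
    proof -
      have "e + (2 * B + e) * e = e * (2 * B + 1 + e)" by (simp add: algebra_simps)
      also have "\<dots> \<le> r / (3 * (2 * B + 3)) * (2 * B + 3)"
        using e B0 r by (intro mult_mono) auto
      also have "\<dots> = r / 3" using B0 by (simp add: field_simps)
      finally show ?thesis .
    qed
    obtain L1 where L1: "\<And>L. L1 \<le> L \<Longrightarrow> \<forall>\<^sub>F n in sequentially. measure M {\<omega>\<in>space M. Y n \<omega> \<notin> cube d L} < e"
      using tight[OF e(1)] by blast
    obtain L2 where L2: "\<And>L. L2 \<le> L \<Longrightarrow> measure N {\<omega>\<in>space N. Z \<omega> \<notin> cube d L} < e"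
      using N.single_tight[OF Z e(1)] by blast
    define L where "L = max 1 (max L1 L2)"
    have L0: "0 < L" by (simp add: L_def)
    obtain g where g: "g \<in> trig_polys d" "\<And>x. x \<in> cube d L \<Longrightarrow> \<bar>f x - g x\<bar> < e" "\<And>x. \<bar>g x\<bar> \<le> B + e"
      using trig_polys_approx[OF f B L0 e(1), where d=d] by blast
    note gc = trig_polys_continuous[OF g(1)]
    have bound: "e + (2 * B + e) * p \<le> r / 3" if "p < e" for p
      using mult_left_mono[of p e "2 * B + e"] that e(1) B0 err by linarith
    have "\<bar>(\<integral>\<omega>. f (Z \<omega>) \<partial>N) - (\<integral>\<omega>. g (Z \<omega>) \<partial>N)\<bar> \<le> r / 3"
      using N.expectation_approx[OF f B gc g(3,2) Z(1)] e(1) B0 bound[OF L2[of L]]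
      by (force simp: L_def)
    moreover have "\<forall>\<^sub>F n in sequentially. \<bar>(\<integral>\<omega>. f (Y n \<omega>) \<partial>M) - (\<integral>\<omega>. g (Y n \<omega>) \<partial>M)\<bar> \<le> r / 3"
    proof -
      have "L1 \<le> L" by (simp add: L_def)
      from L1[OF this] show ?thesis
      proof eventually_elim
        case (elim n)
        show ?case
          using M.expectation_approx[OF f B gc g(3,2) Y[of n]] e(1) B0 bound[OF elim] by force
      qed
    qed
    moreover have "\<forall>\<^sub>F n in sequentially. \<bar>(\<integral>\<omega>. g (Y n \<omega>) \<partial>M) - (\<integral>\<omega>. g (Z \<omega>) \<partial>N)\<bar> < r / 3"
      using tendstoD[OF conjunct2[OF trig_conv[OF g(1)]], of "r / 3"] r by (simp add: dist_real_def)
    ultimately have "\<forall>\<^sub>F n in sequentially. \<bar>(\<integral>\<omega>. f (Z \<omega>) \<partial>N) - (\<integral>\<omega>. g (Z \<omega>) \<partial>N)\<bar> \<le> r / 3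
        \<and> \<bar>(\<integral>\<omega>. f (Y n \<omega>) \<partial>M) - (\<integral>\<omega>. g (Y n \<omega>) \<partial>M)\<bar> \<le> r / 3
        \<and> \<bar>(\<integral>\<omega>. g (Y n \<omega>) \<partial>M) - (\<integral>\<omega>. g (Z \<omega>) \<partial>N)\<bar> < r / 3"
      by (intro eventually_conj) auto
    then have "\<forall>\<^sub>F n in sequentially. norm ((\<integral>\<omega>. f (Y n \<omega>) \<partial>M) - (\<integral>\<omega>. f (Z \<omega>) \<partial>N)) < r"
      by eventually_elim (simp only: real_norm_def, linarith)
    then show "\<exists>no. \<forall>n\<ge>no. norm ((\<integral>\<omega>. f (Y n \<omega>) \<partial>M) - (\<integral>\<omega>. f (Z \<omega>) \<partial>N)) < r"
      by (simp add: eventually_sequentially)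
  qed
qed

section \<open>Central limit theorem and Brownian bridge\<close>

text \<open>A phase turns into a unimodular factor in front of the characteristic function, and the
  cosine is the real part.\<close>

lemma (in prob_space) expectation_cos_of_char:
  assumes [measurable]: "V \<in> borel_measurable M"
  shows "expectation (\<lambda>\<omega>. cos (\<theta> * V \<omega> + \<phi>)) = Re (exp (\<i> * \<phi>) * char (distr M borel V) \<theta>)"
proof -
  have int: "integrable M (\<lambda>\<omega>. iexp (\<theta> * V \<omega>))"
    by (rule integrable_const_bound[of _ 1]) auto
  have "exp (\<i> * \<phi>) * char (distr M borel V) \<theta> = (CLINT \<omega>|M. exp (\<i> * \<phi>) * iexp (\<theta> * V \<omega>))"
    using int by (simp add: char_def integral_distr)
  also have "Re \<dots> = expectation (\<lambda>\<omega>. Re (exp (\<i> * \<phi>) * iexp (\<theta> * V \<omega>)))"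
    using int by (intro integral_Re[symmetric]) auto
  also have "\<dots> = expectation (\<lambda>\<omega>. cos (\<theta> * V \<omega> + \<phi>))"
    by (simp only: cis_conv_exp[symmetric] cis_mult cis.sel add.commute)
  finally show ?thesis by simp
qed

text \<open>The sample is indexed from one, whereas the central limit theorem is applied to
  sequences indexed from zero.\<close>

lemma (in prob_space) indep_vars_Suc:
  assumes "indep_vars (\<lambda>_. K) X {1..}"
  shows "indep_vars (\<lambda>_. K) (\<lambda>i. X (Suc i)) UNIV"
  unfolding indep_vars_def2
proof
  show "\<forall>i\<in>UNIV. random_variable K (X (Suc i))"
    using assms by (simp add: indep_vars_def2)
  have ind: "indep_sets (\<lambda>i. {X i -` A \<inter> space M | A. A \<in> sets K}) {1..}"
    using assms by (simp add: indep_vars_def2)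
  show "indep_sets (\<lambda>i. {X (Suc i) -` A \<inter> space M | A. A \<in> sets K}) UNIV"
  proof (rule indep_setsI)
    show "{X (Suc i) -` A \<inter> space M | A. A \<in> sets K} \<subseteq> events" for i
      using assms by (auto simp: indep_vars_def2 intro: measurable_sets)
    fix A and J :: "nat set"
    assume J: "J \<noteq> {}" "finite J" and A: "\<forall>j\<in>J. A j \<in> {X (Suc j) -` A \<inter> space M | A. A \<in> sets K}"
    have "prob (\<Inter>j\<in>Suc ` J. A (j - 1)) = (\<Prod>j\<in>Suc ` J. prob (A (j - 1)))"
      using J A by (intro indep_setsD[OF ind]) auto
    then show "prob (\<Inter>j\<in>J. A j) = (\<Prod>j\<in>J. prob (A j))"
      by (simp add: prod.reindex image_image)
  qed
qed

lemma (in prob_space) variance_sum_indep: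
  fixes Y :: "nat \<Rightarrow> 'a \<Rightarrow> real"
  assumes ind: "indep_vars (\<lambda>_. borel) Y UNIV"
    and int2: "\<And>i. integrable M (\<lambda>\<omega>. (Y i \<omega>)\<^sup>2)"
    and mean: "\<And>i. expectation (Y i) = 0" and var: "\<And>i. expectation (\<lambda>\<omega>. (Y i \<omega>)\<^sup>2) = v"
  shows "integrable M (\<lambda>\<omega>. (\<Sum>i<n. Y i \<omega>)\<^sup>2) \<and> expectation (\<lambda>\<omega>. (\<Sum>i<n. Y i \<omega>)\<^sup>2) = real n * v"
proof (induction n)
  case (Suc n)
  have [measurable]: "Y i \<in> borel_measurable M" for i
    using ind by (simp add: indep_vars_def2)
  have int: "integrable M (Y i)" for i
    by (rule square_integrable_imp_integrable[OF _ int2]) simp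
  have ints: "integrable M (\<lambda>\<omega>. \<Sum>i<n. Y i \<omega>)" using int by simp
  have iv: "indep_var borel (Y n) borel (\<lambda>\<omega>. \<Sum>i<n. Y i \<omega>)"
    by (intro indep_vars_sum indep_vars_subset[OF ind]) auto
  note prod = indep_var_lebesgue_integral[OF iv int ints] indep_var_integrable[OF iv int ints]
  have eq: "(\<Sum>i<Suc n. Y i \<omega>)\<^sup>2 = (\<Sum>i<n. Y i \<omega>)\<^sup>2 + (Y n \<omega>)\<^sup>2 + 2 * (Y n \<omega> * (\<Sum>i<n. Y i \<omega>))" for \<omega>
    by (simp add: power2_eq_square algebra_simps)
  show ?case unfolding eq using Suc int2 prod mean var by (simp add: algebra_simps)
qed simp

text \<open>Central limit theorem and Levy continuity, evaluated at the frequency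
  \<open>\<sigma>\<close>, which cancels the standard deviation in the normalization.\<close>

lemma tendsto_cos_sum_iid:
  fixes Y :: "nat \<Rightarrow> 'a \<Rightarrow> real"
  assumes M: "prob_space M"
    and ind: "prob_space.indep_vars M (\<lambda>_. borel) Y UNIV"
    and int2: "\<And>i. integrable M (\<lambda>\<omega>. (Y i \<omega>)\<^sup>2)"
    and mean: "\<And>i. integral\<^sup>L M (Y i) = 0" and var: "\<And>i. integral\<^sup>L M (\<lambda>\<omega>. (Y i \<omega>)\<^sup>2) = v"
    and dist: "\<And>i. distr M borel (Y i) = \<mu>"
  shows "(\<lambda>n. \<integral>\<omega>. cos ((\<Sum>i<n. Y i \<omega>) / sqrt (real n) + \<phi>) \<partial>M) \<longlonglongrightarrow> exp (- v / 2) * cos \<phi>"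
proof -
  interpret prob_space M by (rule M)
  have [measurable]: "Y i \<in> borel_measurable M" for i
    using ind by (simp add: indep_vars_def2)
  have v0: "0 \<le> v" using var[of 0] by (metis integral_nonneg_AE AE_I2 zero_le_power2)
  show ?thesis
  proof (cases "v = 0")
    \<comment> \<open>The degenerate case arises for linear functionals that are constant on the
      support; all summands then vanish almost surely.\<close>
    case True
    have "AE \<omega> in M. Y i \<omega> = 0" for i
      using integral_nonneg_eq_0_iff_AE[OF int2[of i]] var[of i] True by simp
    then have "AE \<omega> in M. \<forall>i. Y i \<omega> = 0" by (simp add: AE_all_countable)
    then have "(\<integral>\<omega>. cos ((\<Sum>i<n. Y i \<omega>) / sqrt (real n) + \<phi>) \<partial>M) = (\<integral>\<omega>. cos \<phi> \<partial>M)" for n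
      by (intro integral_cong_AE) auto
    then show ?thesis by (simp add: True prob_space)
  next
    case False
    define \<sigma> where "\<sigma> = sqrt v"
    have \<sigma>: "0 < \<sigma>" "\<sigma>\<^sup>2 = v" using False v0 by (auto simp: \<sigma>_def)
    define V where "V n \<omega> = (\<Sum>i<n. Y i \<omega>) / sqrt (real n * \<sigma>\<^sup>2)" for n \<omega>
    have [measurable]: "V n \<in> borel_measurable M" for n unfolding V_def by simp
    have "weak_conv_m (\<lambda>n. distr M borel (V n)) std_normal_distribution"
      unfolding V_def
      by (rule central_limit_theorem_zero_mean[OF ind mean \<sigma>(1) int2 _ dist])
         (simp add: mean var \<sigma>)
    then have "(\<lambda>n. char (distr M borel (V n)) \<sigma>) \<longlonglongrightarrow> char std_normal_distribution \<sigma>"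
      by (intro levy_continuity1 real_distribution_distr real_dist_normal_dist) auto
    then have "(\<lambda>n. Re (exp (\<i> * \<phi>) * char (distr M borel (V n)) \<sigma>))
        \<longlonglongrightarrow> Re (exp (\<i> * \<phi>) * char std_normal_distribution \<sigma>)"
      by (intro tendsto_intros)
    moreover have "Re (exp (\<i> * \<phi>) * char std_normal_distribution \<sigma>) = exp (- v / 2) * cos \<phi>"
      by (simp add: char_std_normal_distribution \<sigma> Re_exp)
    moreover have "(\<integral>\<omega>. cos ((\<Sum>i<n. Y i \<omega>) / sqrt (real n) + \<phi>) \<partial>M)
        = Re (exp (\<i> * \<phi>) * char (distr M borel (V n)) \<sigma>)" for n
    proof -
      have "\<sigma> * V n \<omega> = (\<Sum>i<n. Y i \<omega>) / sqrt (real n)" for \<omega>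
        using \<sigma>(1) by (simp add: V_def real_sqrt_mult)
      then show ?thesis
        using expectation_cos_of_char[of "V n" \<sigma> \<phi>] by (simp only: measurable)
    qed
    ultimately show ?thesis by (simp only:)
  qed
qed

text \<open>Abel summation, with \<open>t\<close> extended by zero past \<open>d\<close> so that the
  boundary term disappears. It passes between bridge increments and bridge values, whose covariance
  is the one prescribed.\<close>

lemma sum_by_parts:
  fixes t v :: "nat \<Rightarrow> real"
  shows "(\<Sum>i<d. (t i - (if Suc i < d then t (Suc i) else 0)) * v i)
    = (\<Sum>k<d. t k * (v k - (if k = 0 then 0 else v (k - 1))))"
proof -
  define u where "u k = (if k < d then t k else 0)" for k
  have "(\<Sum>k<m. u k * (v k - (if k = 0 then 0 else v (k - 1))))
      = (\<Sum>i<m. (u i - u (Suc i)) * v i) + u m * (if m = 0 then 0 else v (m - 1))" for m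
    by (induction m) (auto simp: algebra_simps)
  from this[of d] show ?thesis by (simp add: u_def)
qed

lemma brownian_bridge_expectation_cos:
  fixes n :: nat and a t :: "nat \<Rightarrow> real"
  assumes bb: "brownian_bridge N U" and t: "\<And>i. i < n \<Longrightarrow> t i \<in> {0..1}"
  shows "(\<integral>\<omega>. cos ((\<Sum>i<n. a i * U \<omega> (t i)) + \<phi>) \<partial>N)
    = exp (- (\<Sum>i<n. \<Sum>j<n. a i * a j * (min (t i) (t j) - t i * t j)) / 2) * cos \<phi>"
proof -
  interpret prob_space N using bb by (simp add: brownian_bridge_def)
  have "(\<lambda>\<omega>. U \<omega> (t i)) \<in> borel_measurable N" if "i < n" for i
    using bb t[OF that] by (simp add: brownian_bridge_def)
  then have "(\<lambda>\<omega>. \<Sum>i<n. a i * U \<omega> (t i)) \<in> borel_measurable N" by simp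
  note cos_char = expectation_cos_of_char[OF this, of 1 \<phi>]
  have "char (distr N borel (\<lambda>\<omega>. \<Sum>i<n. a i * U \<omega> (t i))) 1 = complex_of_real (exp (- (1\<^sup>2 / 2) *
      (\<Sum>i<n. \<Sum>j<n. a i * a j * (min (t i) (t j) - t i * t j))))"
    using bb t unfolding brownian_bridge_def by blast
  with cos_char show ?thesis by (simp add: Re_exp)
qed

section \<open>Linear functionals of the bridge increments\<close>

context
  fixes p0 :: "nat \<Rightarrow> real" and S :: nat
  assumes supp: "{k. p0 k \<noteq> 0} = {0..S}" and nonneg: "\<forall>k. 0 \<le> p0 k" and total: "(\<Sum>k\<le>S. p0 k) = 1"
begin

lemma p0_zero: "S < k \<Longrightarrow> p0 k = 0"
  using supp by (metis (mono_tags, lifting) atLeastAtMost_iff mem_Collect_eq not_le)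

lemma sum_p0: "S \<le> m \<Longrightarrow> (\<Sum>k\<le>m. p0 k * f k) = (\<Sum>k\<le>S. p0 k * f k)"
  by (rule sum.mono_neutral_right) (auto simp: p0_zero)

lemma Fp_nat: "Fp p0 (int k) = (\<Sum>j\<le>k. p0 j)"
  by (simp add: Fp_def)

lemma Fp_eq_1: "S \<le> k \<Longrightarrow> Fp p0 (int k) = 1"
  using sum_p0[of k "\<lambda>_. 1"] total by (simp add: Fp_nat)

lemma Fp_pred: "Fp p0 (int k - 1) = (if k = 0 then 0 else Fp p0 (int (k - 1)))"
  by (cases k) (auto simp: Fp_def)

lemma Fp_diff: "Fp p0 (int k) - (if k = 0 then 0 else Fp p0 (int (k - 1))) = p0 k"
  unfolding Fp_nat by (cases k) auto

lemma Fp_mono: "i \<le> k \<Longrightarrow> Fp p0 (int i) \<le> Fp p0 (int k)"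
  unfolding Fp_nat using nonneg by (intro sum_mono2) auto

lemma Fp_range: "Fp p0 (int k) \<in> {0..1}"
proof -
  have "Fp p0 (int k) \<le> Fp p0 (int (max k S))" by (rule Fp_mono) simp
  also have "\<dots> = 1" by (rule Fp_eq_1) simp
  finally show ?thesis using nonneg by (simp add: Fp_nat sum_nonneg)
qed

lemma Wvec_zero: "u 0 = 0 \<Longrightarrow> S + 1 \<le> k \<Longrightarrow> Wvec p0 u k = 0"
  unfolding Wvec_def Fp_pred using Fp_eq_1[of k] Fp_eq_1[of "k - 1"] by simp

lemma Wvec_sum: "u 0 = 0 \<Longrightarrow> (\<Sum>k<s. Wvec p0 u k) = u (Fp p0 (int s - 1))"
proof (induction s)
  case 0 then show ?case by (simp add: Fp_def)
qed (simp add: Wvec_def)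

text \<open>The variance of \<open>t\<close> under \<open>p0\<close>.\<close>

definition score_variance :: "(nat \<Rightarrow> real) \<Rightarrow> real" where
  "score_variance t = (\<Sum>k\<le>S. p0 k * (t k)\<^sup>2) - (\<Sum>k\<le>S. p0 k * t k)\<^sup>2"

text \<open>Abel summation is applied in each index. In \<open>i\<close> it turns the covariance
  part \<open>min (F i) (F j)\<close> into a partial sum of \<open>t k * p0 k\<close>, in
  \<open>j\<close> it leaves the second moment of \<open>t\<close>; the product part of the
  covariance factors into the square of the mean.\<close>

lemma bridge_variance:
  fixes t :: "nat \<Rightarrow> real"
  defines "a i \<equiv> t i - (if Suc i < S + 2 then t (Suc i) else 0)"
  shows "(\<Sum>i<S+2. \<Sum>j<S+2. a i * a j *
      (min (Fp p0 (int i)) (Fp p0 (int j)) - Fp p0 (int i) * Fp p0 (int j))) = score_variance t"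
proof -
  define F where "F k = Fp p0 (int k)" for k
  have F_diff: "F k - (if k = 0 then 0 else F (k - 1)) = p0 k" for k
    unfolding F_def by (rule Fp_diff)
  have F_mono: "i \<le> k \<Longrightarrow> F i \<le> F k" for i k unfolding F_def by (rule Fp_mono)
  have F0: "0 \<le> F j" for j using Fp_range[of j] by (simp add: F_def)
  have abel: "(\<Sum>i<S+2. a i * v i) = (\<Sum>k<S+2. t k * (v k - (if k = 0 then 0 else v (k - 1))))" for v
    unfolding a_def by (rule sum_by_parts)
  have min_diff: "min (F k) (F j) - (if k = 0 then 0 else min (F (k - 1)) (F j)) = (if k \<le> j then p0 k else 0)"
    for j k
  proof (cases "k \<le> j")
    case True
    then have "F k \<le> F j" "F (k - 1) \<le> F j" by (auto intro: F_mono)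
    then show ?thesis using True F_diff[of k] by (auto simp: min_def)
  next
    case False
    then have "F j \<le> F k" "F j \<le> F (k - 1)" by (auto intro: F_mono)
    then show ?thesis using False by (auto simp: min_def)
  qed
  have lin: "(\<Sum>i<S+2. a i * F i) = (\<Sum>k<S+2. t k * p0 k)"
    unfolding abel F_diff ..
  have inner: "(\<Sum>i<S+2. a i * min (F i) (F j)) = (\<Sum>k<S+2. if k \<le> j then t k * p0 k else 0)" for j
    unfolding abel min_diff by (intro sum.cong) auto
  define G where "G j = (\<Sum>k<S+2. if k \<le> j then t k * p0 k else 0)" for j
  have G_diff: "G j - (if j = 0 then 0 else G (j - 1)) = t j * p0 j" if "j < S + 2" for j
  proof -
    have G: "G i = (\<Sum>k\<le>i. t k * p0 k)" if "i < S + 2" for i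
      unfolding G_def using that by (intro sum.mono_neutral_cong_right) auto
    show ?thesis using that by (cases j) (auto simp: G)
  qed
  have quad: "(\<Sum>j<S+2. a j * G j) = (\<Sum>k<S+2. t k * (t k * p0 k))"
    unfolding abel by (intro sum.cong) (auto simp: G_diff simp del: sum.lessThan_Suc)
  have "(\<Sum>i<S+2. \<Sum>j<S+2. a i * a j * (min (F i) (F j) - F i * F j))
      = (\<Sum>i<S+2. \<Sum>j<S+2. a j * (a i * min (F i) (F j))) - (\<Sum>i<S+2. \<Sum>j<S+2. (a i * F i) * (a j * F j))"
    unfolding sum_subtractf[symmetric] by (intro sum.cong refl) (simp add: algebra_simps)
  also have "(\<Sum>i<S+2. \<Sum>j<S+2. a j * (a i * min (F i) (F j))) = (\<Sum>j<S+2. a j * G j)"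
    unfolding G_def inner[symmetric] by (subst sum.swap) (simp only: sum_distrib_left)
  also have "(\<Sum>i<S+2. \<Sum>j<S+2. (a i * F i) * (a j * F j)) = (\<Sum>i<S+2. a i * F i)\<^sup>2"
    unfolding power2_eq_square sum_product ..
  also have "(\<Sum>j<S+2. a j * G j) - (\<Sum>i<S+2. a i * F i)\<^sup>2 = score_variance t"
  proof -
    have "{..<S+2} = {..S+1}" by auto
    then show ?thesis
      using sum_p0[of "S+1" "\<lambda>k. (t k)\<^sup>2"] sum_p0[of "S+1" t]
      unfolding quad lin score_variance_def by (simp add: power2_eq_square mult_ac del: sum.atMost_Suc sum.lessThan_Suc)
  qed
  finally show ?thesis by (simp only: F_def)
qed

lemma Wvec_expectation_cos:
  assumes bb: "brownian_bridge N U"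
  shows "(\<integral>\<omega>. cos ((\<Sum>k<S+2. t k * Wvec p0 (U \<omega>) k) + \<phi>) \<partial>N) = exp (- score_variance t / 2) * cos \<phi>"
proof -
  define a where "a i = t i - (if Suc i < S + 2 then t (Suc i) else 0)" for i
  have "(\<Sum>k<S+2. t k * Wvec p0 (U \<omega>) k) = (\<Sum>i<S+2. a i * U \<omega> (Fp p0 (int i)))" if "\<omega> \<in> space N" for \<omega>
  proof -
    have "U \<omega> 0 = 0" using bb that by (simp add: brownian_bridge_def)
    then have "Wvec p0 (U \<omega>) k = U \<omega> (Fp p0 (int k)) - (if k = 0 then 0 else U \<omega> (Fp p0 (int (k - 1))))" for k
      unfolding Wvec_def Fp_pred by simp
    then show ?thesis unfolding a_def using sum_by_parts[where v="\<lambda>i. U \<omega> (Fp p0 (int i))" and d="S+2" and t=t]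
      by (simp only:)
  qed
  then have "(\<integral>\<omega>. cos ((\<Sum>k<S+2. t k * Wvec p0 (U \<omega>) k) + \<phi>) \<partial>N)
      = (\<integral>\<omega>. cos ((\<Sum>i<S+2. a i * U \<omega> (Fp p0 (int i))) + \<phi>) \<partial>N)"
    by (intro Bochner_Integration.integral_cong) (auto simp del: sum.lessThan_Suc)
  also have "\<dots> = exp (- score_variance t / 2) * cos \<phi>"
    using brownian_bridge_expectation_cos[OF bb, of "S+2" "\<lambda>i. Fp p0 (int i)" a \<phi>] Fp_range
    unfolding a_def bridge_variance by blast
  finally show ?thesis .
qed

lemma Wvec_measurable:
  assumes bb: "brownian_bridge N U"
  shows "(\<lambda>\<omega>. Wvec p0 (U \<omega>)) \<in> borel_measurable N"
proof (rule measurable_coordinatewise_then_product)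
  fix k
  have m: "(\<lambda>\<omega>. U \<omega> t) \<in> borel_measurable N" if "t \<in> {0..1}" for t
    using bb that by (simp add: brownian_bridge_def)
  have "Fp p0 (int k - 1) \<in> {0..1}" unfolding Fp_pred using Fp_range[of "k - 1"] by auto
  then show "(\<lambda>\<omega>. Wvec p0 (U \<omega>) k) \<in> borel_measurable N"
    unfolding Wvec_def using Fp_range by (intro borel_measurable_diff m)
qed

end

section \<open>The estimator under i.i.d. sampling\<close>

text \<open>Only the events \<open>E n\<close> contribute to the difference, at most
  \<open>2 * B\<close> times their probability. The index zero, where the empirical frequencies
  divide by zero, is excluded from the comparison.\<close>

lemma (in prob_space) integral_diff_tendsto_0:
  fixes f g :: "nat \<Rightarrow> 'a \<Rightarrow> real"
  assumes meas: "\<And>n. f n \<in> borel_measurable M" "\<And>n. g n \<in> borel_measurable M"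
    and bound: "\<And>n \<omega>. \<bar>f n \<omega>\<bar> \<le> B" "\<And>n \<omega>. \<bar>g n \<omega>\<bar> \<le> B"
    and E: "\<And>n. E n \<in> events" "(\<lambda>n. prob (E n)) \<longlonglongrightarrow> 0"
    and eq: "\<And>n \<omega>. 1 \<le> n \<Longrightarrow> \<omega> \<in> space M \<Longrightarrow> \<omega> \<notin> E n \<Longrightarrow> f n \<omega> = g n \<omega>"
  shows "(\<lambda>n. (\<integral>\<omega>. f n \<omega> \<partial>M) - (\<integral>\<omega>. g n \<omega> \<partial>M)) \<longlonglongrightarrow> 0"
proof (rule Lim_null_comparison)
  have int: "integrable M (f n)" "integrable M (g n)" for n
    using meas bound by (auto intro!: integrable_const_bound[of _ B])
  show "\<forall>\<^sub>F n in sequentially. norm ((\<integral>\<omega>. f n \<omega> \<partial>M) - (\<integral>\<omega>. g n \<omega> \<partial>M)) \<le> (2 * B) * prob (E n)"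
  proof (rule eventually_sequentiallyI[of 1])
    fix n :: nat assume n: "1 \<le> n"
    have "\<bar>(\<integral>\<omega>. f n \<omega> \<partial>M) - (\<integral>\<omega>. g n \<omega> \<partial>M)\<bar> = \<bar>\<integral>\<omega>. f n \<omega> - g n \<omega> \<partial>M\<bar>"
      using int by simp
    also have "\<dots> \<le> (\<integral>\<omega>. \<bar>f n \<omega> - g n \<omega>\<bar> \<partial>M)" by (rule integral_abs_bound)
    also have "\<dots> \<le> (\<integral>\<omega>. (2 * B) * indicator (E n) \<omega> \<partial>M)"
    proof (rule integral_mono)
      fix \<omega> assume \<omega>: "\<omega> \<in> space M"
      show "\<bar>f n \<omega> - g n \<omega>\<bar> \<le> (2 * B) * indicator (E n) \<omega>"
      proof (cases "\<omega> \<in> E n")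
        case True then show ?thesis using bound[of n \<omega>] by simp
      next
        case False then show ?thesis using eq[OF n \<omega>] by simp
      qed
    qed (use int E in \<open>auto intro!: integrable_mult_right simp: emeasure_eq_measure\<close>)
    also have "\<dots> = (2 * B) * prob (E n)" using E by simp
    finally show "norm ((\<integral>\<omega>. f n \<omega> \<partial>M) - (\<integral>\<omega>. g n \<omega> \<partial>M)) \<le> (2 * B) * prob (E n)" by simp
  qed
  show "(\<lambda>n. (2 * B) * prob (E n)) \<longlonglongrightarrow> 0"
    using tendsto_mult_left[OF E(2), of "2 * B"] by simp
qed

text \<open>One direction splits the expectation at the level \<open>r / 2\<close>, the other is
  Markov's inequality. The bounded form is accessible to convergence in distribution.\<close>

lemma (in prob_space) o_p_one_iff:
  assumes R [measurable]: "\<And>n. R n \<in> borel_measurable M"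
  shows "o_p_one M R \<longleftrightarrow> (\<lambda>n. expectation (\<lambda>\<omega>. min 1 \<bar>R n \<omega>\<bar>)) \<longlonglongrightarrow> 0" (is "_ \<longleftrightarrow> ?E \<longlonglongrightarrow> 0")
proof
  have int: "integrable M (\<lambda>\<omega>. min 1 \<bar>R n \<omega>\<bar>)" for n
    by (rule integrable_const_bound[of _ 1]) auto
  have nonneg: "0 \<le> ?E n" for n by (rule integral_nonneg_AE) auto
  {
    assume o: "o_p_one M R"
    show "?E \<longlonglongrightarrow> 0"
    proof (rule LIMSEQ_I)
      fix r :: real assume r: "0 < r"
      have "(\<lambda>n. prob {\<omega>\<in>space M. \<bar>R n \<omega>\<bar> > r / 2}) \<longlonglongrightarrow> 0"
        using o half_gt_zero[OF r] unfolding o_p_one_def by blast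
      then have "\<forall>\<^sub>F n in sequentially. prob {\<omega>\<in>space M. \<bar>R n \<omega>\<bar> > r / 2} < r / 2"
        by (rule order_tendstoD) (use r in simp)
      then have "\<forall>\<^sub>F n in sequentially. norm (?E n - 0) < r"
      proof eventually_elim
        case (elim n)
        define A where "A = {\<omega>\<in>space M. \<bar>R n \<omega>\<bar> > r / 2}"
        have A: "A \<in> events" unfolding A_def by measurable
        have "?E n \<le> expectation (\<lambda>\<omega>. r / 2 + indicator A \<omega>)"
        proof (rule integral_mono[OF int])
          fix \<omega> assume "\<omega> \<in> space M"
          then show "min 1 \<bar>R n \<omega>\<bar> \<le> r / 2 + indicator A \<omega>"
            using r by (cases "\<omega> \<in> A") (auto simp: A_def)
        qed (use A in \<open>auto simp: emeasure_eq_measure\<close>)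
        also have "\<dots> = r / 2 + prob A"
          using A by (subst Bochner_Integration.integral_add) (auto simp: prob_space emeasure_eq_measure)
        also have "\<dots> < r" using elim by (simp add: A_def)
        finally show ?case using nonneg[of n] by simp
      qed
      then show "\<exists>no. \<forall>n\<ge>no. norm (?E n - 0) < r" by (simp add: eventually_sequentially)
    qed
  }
  assume E0: "?E \<longlonglongrightarrow> 0"
  show "o_p_one M R" unfolding o_p_one_def
  proof (intro allI impI)
    fix \<epsilon> :: real assume \<epsilon>: "0 < \<epsilon>"
    \<comment> \<open>The truncated variable never exceeds one, so the level in Markov's inequality
      is capped accordingly.\<close>
    define c where "c = min 1 \<epsilon>"
    have c: "0 < c" using \<epsilon> by (simp add: c_def)
    show "(\<lambda>n. prob {\<omega>\<in>space M. \<bar>R n \<omega>\<bar> > \<epsilon>}) \<longlonglongrightarrow> 0"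
    proof (rule Lim_null_comparison)
      have "prob {\<omega>\<in>space M. \<bar>R n \<omega>\<bar> > \<epsilon>} \<le> ?E n / c" for n
      proof -
        have "prob {\<omega>\<in>space M. \<bar>R n \<omega>\<bar> > \<epsilon>} \<le> prob {\<omega>\<in>space M. min 1 \<bar>R n \<omega>\<bar> \<ge> c}"
          by (rule finite_measure_mono) (auto simp: c_def min_def)
        also have "\<dots> \<le> ?E n / c"
          by (rule integral_Markov_inequality_measure[OF int, of "{}"]) (use c in auto)
        finally show ?thesis .
      qed
      then show "\<forall>\<^sub>F n in sequentially. norm (prob {\<omega>\<in>space M. \<bar>R n \<omega>\<bar> > \<epsilon>}) \<le> ?E n / c"
        by (simp add: measure_nonneg)
      show "(\<lambda>n. ?E n / c) \<longlonglongrightarrow> 0" using tendsto_divide[OF E0 tendsto_const, of c] c by simp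
    qed
  qed
qed

locale iid_sample = prob_space M for M :: "'a measure" +
  fixes X :: "nat \<Rightarrow> 'a \<Rightarrow> nat" and p0 :: "nat \<Rightarrow> real" and S :: nat
  assumes supp: "{k. p0 k \<noteq> 0} = {0..S}" and nonneg: "\<forall>k. 0 \<le> p0 k" and total: "(\<Sum>k\<le>S. p0 k) = 1"
    and X_meas: "\<forall>i\<ge>1. X i \<in> measurable M (count_space UNIV)"
    and X_indep: "indep_vars (\<lambda>_. count_space UNIV) X {1..}"
    and X_distr: "\<forall>i\<ge>1. \<forall>j. prob {\<omega>\<in>space M. X i \<omega> = j} = p0 j"
begin

lemmas pmf_facts = supp nonneg total

lemma AE_sample_le: "AE \<omega> in M. \<forall>i\<ge>1. X i \<omega> \<le> S"
proof -
  have "AE \<omega> in M. 1 \<le> i \<longrightarrow> S < j \<longrightarrow> X i \<omega> \<noteq> j" for i j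
  proof (cases "1 \<le> i \<and> S < j")
    case True
    then have "X i \<in> measurable M (count_space UNIV)" using X_meas by simp
    then have "{\<omega>\<in>space M. X i \<omega> = j} \<in> events" by measurable
    moreover have "prob {\<omega>\<in>space M. X i \<omega> = j} = 0"
      using X_distr True p0_zero[OF pmf_facts] by simp
    ultimately have "AE \<omega> in M. \<omega> \<notin> {\<omega>\<in>space M. X i \<omega> = j}" by (simp add: prob_eq_0)
    then show ?thesis using AE_space by eventually_elim simp
  qed auto
  then have "AE \<omega> in M. \<forall>i j. 1 \<le> i \<longrightarrow> S < j \<longrightarrow> X i \<omega> \<noteq> j" by (simp add: AE_all_countable)
  then show ?thesis by eventually_elim (metis not_le)
qed

text \<open>Almost surely the observation is at most \<open>S\<close>, so the variable is a finite
  combination of indicators.\<close>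

lemma sample_comp:
  fixes \<tau> :: "nat \<Rightarrow> real"
  assumes i: "1 \<le> i"
  shows "integrable M (\<lambda>\<omega>. \<tau> (X i \<omega>))" "expectation (\<lambda>\<omega>. \<tau> (X i \<omega>)) = (\<Sum>k\<le>S. p0 k * \<tau> k)"
proof -
  have [measurable]: "X i \<in> measurable M (count_space UNIV)" using X_meas i by simp
  define A where "A k = {\<omega>\<in>space M. X i \<omega> = k}" for k
  have A: "A k \<in> events" for k unfolding A_def by measurable
  have eq: "AE \<omega> in M. (\<Sum>k\<le>S. \<tau> k * indicator (A k) \<omega>) = \<tau> (X i \<omega>)"
    using AE_sample_le AE_space
  proof eventually_elim
    case (elim \<omega>)
    then have "(\<Sum>k\<le>S. \<tau> k * indicator (A k) \<omega>) = (\<Sum>k\<le>S. if k = X i \<omega> then \<tau> k else 0)"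
      by (intro sum.cong) (auto simp: A_def)
    also have "\<dots> = \<tau> (X i \<omega>)" using elim i by simp
    finally show ?case .
  qed
  have int: "integrable M (\<lambda>\<omega>. \<Sum>k\<le>S. \<tau> k * indicator (A k) \<omega>)"
    using A by (intro Bochner_Integration.integrable_sum integrable_mult_right) (auto simp: emeasure_eq_measure)
  show "integrable M (\<lambda>\<omega>. \<tau> (X i \<omega>))"
    by (rule integrable_cong_AE_imp[OF int _ eq]) simp
  have "expectation (\<lambda>\<omega>. \<tau> (X i \<omega>)) = expectation (\<lambda>\<omega>. \<Sum>k\<le>S. \<tau> k * indicator (A k) \<omega>)"
    by (rule integral_cong_AE[OF _ borel_measurable_integrable[OF int] AE_symmetric[OF eq]]) simp
  also have "\<dots> = (\<Sum>k\<le>S. \<tau> k * prob (A k))"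
    using A by (subst Bochner_Integration.integral_sum) (auto simp: emeasure_eq_measure)
  also have "\<dots> = (\<Sum>k\<le>S. p0 k * \<tau> k)"
    using X_distr i by (simp add: A_def mult.commute)
  finally show "expectation (\<lambda>\<omega>. \<tau> (X i \<omega>)) = (\<Sum>k\<le>S. p0 k * \<tau> k)" .
qed

text \<open>The empirical frequencies are a function of the list of the first \<open>n\<close>
  observations, which lives in a countable discrete space where every function is measurable. This
  covers the estimator itself.\<close>

lemma sample_function_measurable: "(\<lambda>\<omega>. h (emp_pmf X n \<omega>)) \<in> borel_measurable M"
  for h :: "(nat \<Rightarrow> real) \<Rightarrow> 'c :: topological_space"
proof -
  define xs where "xs \<omega> = map (\<lambda>i. X i \<omega>) [1..<Suc n]" for \<omega>
  have "xs \<in> measurable M (count_space UNIV)"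
    unfolding measurable_count_space_eq2_countable
  proof (intro conjI ballI)
    fix ys :: "nat list"
    have "xs -` {ys} \<inter> space M
        = (if length ys = n then {\<omega>\<in>space M. \<forall>i\<in>{1..n}. X i \<omega> = ys ! (i - 1)} else {})"
    proof -
      have "xs \<omega> = ys \<longleftrightarrow> length ys = n \<and> (\<forall>i\<in>{1..n}. X i \<omega> = ys ! (i - 1))" for \<omega>
      proof -
        have "(\<forall>i<n. X (Suc i) \<omega> = ys ! i) \<longleftrightarrow> (\<forall>i\<in>{1..n}. X i \<omega> = ys ! (i - 1))"
          unfolding image_Suc_lessThan[symmetric] by auto
        then show ?thesis by (auto simp: xs_def list_eq_iff_nth_eq simp del: upt_Suc)
      qed
      then show ?thesis by auto
    qed
    moreover have "{\<omega>\<in>space M. \<forall>i\<in>{1..n}. X i \<omega> = ys ! (i - 1)} \<in> events"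
    proof (rule sets.sets_Collect_finite_All)
      fix i assume "i \<in> {1..n}"
      then have "X i \<in> measurable M (count_space UNIV)" using X_meas by simp
      then show "{\<omega>\<in>space M. X i \<omega> = ys ! (i - 1)} \<in> events" by measurable
    qed simp
    ultimately show "xs -` {ys} \<inter> space M \<in> events" by simp
  qed simp
  then have "(\<lambda>\<omega>. h (emp_pmf (\<lambda>i zs. zs ! (i - 1)) n (xs \<omega>))) \<in> borel_measurable M"
    by (rule measurable_compose) simp
  moreover have "emp_pmf (\<lambda>i zs. zs ! (i - 1)) n (xs \<omega>) = emp_pmf X n \<omega>" for \<omega>
  proof -
    have "xs \<omega> ! (i - 1) = X i \<omega>" if "i \<in> {1..n}" for i
      using that by (auto simp: xs_def simp del: upt_Suc)
    then show ?thesis by (simp add: emp_pmf_def fun_eq_iff cong: conj_cong)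
  qed
  ultimately show ?thesis by simp
qed

text \<open>The cut past \<open>S + 1\<close> matches the index range of the cone; what is removed
  is zero whenever all observations are at most \<open>S\<close>.\<close>

definition Wn :: "nat \<Rightarrow> 'a \<Rightarrow> nat \<Rightarrow> real" where
  "Wn n \<omega> k = (if k \<le> S + 1 then sqrt (real n) * (emp_pmf X n \<omega> k - p0 k) else 0)"

lemma emp_pmf_eq: "emp_pmf X n \<omega> k = (\<Sum>i<n. of_bool (X (Suc i) \<omega> = k)) / real n"
proof -
  have "real (card {i\<in>{1..n}. X i \<omega> = k}) = (\<Sum>i\<in>{Suc 0..n}. of_bool (X i \<omega> = k))"
    by (simp add: Int_def)
  also have "\<dots> = (\<Sum>i<n. of_bool (X (Suc i) \<omega> = k))" by (rule sum.atLeast1_atMost_eq)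
  finally show ?thesis by (simp add: emp_pmf_def)
qed

text \<open>The centred contribution of one observation to the linear functional \<open>t\<close>;
  the cutoff at \<open>S + 2\<close> reflects the one in \<open>Wn\<close>.\<close>

definition score :: "(nat \<Rightarrow> real) \<Rightarrow> nat \<Rightarrow> 'a \<Rightarrow> real" where
  "score t i \<omega> = (if X (Suc i) \<omega> < S + 2 then t (X (Suc i) \<omega>) else 0) - (\<Sum>k\<le>S. p0 k * t k)"

text \<open>Exchanging the sums over values and observations gives the Cramer-Wold reduction to a
  scalar sum of independent terms.\<close>

lemma Wn_linear: "(\<Sum>k<S+2. t k * Wn n \<omega> k) = (\<Sum>i<n. score t i \<omega>) / sqrt (real n)"
proof (cases "n = 0")
  case False
  have m: "(\<Sum>k<S+2. t k * p0 k) = (\<Sum>k\<le>S. p0 k * t k)"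
  proof -
    have "{..<S+2} = {..S+1}" by auto
    then show ?thesis using sum_p0[OF pmf_facts, of "S+1" t] by (simp add: mult.commute)
  qed
  have "(\<Sum>k<S+2. t k * emp_pmf X n \<omega> k)
      = (\<Sum>i<n. \<Sum>k<S+2. t k * of_bool (X (Suc i) \<omega> = k)) / real n"
    unfolding emp_pmf_eq
    by (subst sum.swap) (simp only: sum_distrib_left sum_divide_distrib times_divide_eq_right)
  also have "(\<Sum>i<n. \<Sum>k<S+2. t k * of_bool (X (Suc i) \<omega> = k))
      = (\<Sum>i<n. if X (Suc i) \<omega> < S + 2 then t (X (Suc i) \<omega>) else 0)"
  proof (rule sum.cong[OF refl])
    fix i
    have "(\<Sum>k<S+2. t k * of_bool (X (Suc i) \<omega> = k)) = (\<Sum>k<S+2. if k = X (Suc i) \<omega> then t k else 0)"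
      by (intro sum.cong) auto
    also have "\<dots> = (if X (Suc i) \<omega> < S + 2 then t (X (Suc i) \<omega>) else 0)"
      by (subst sum.delta) auto
    finally show "(\<Sum>k<S+2. t k * of_bool (X (Suc i) \<omega> = k)) = \<dots>" .
  qed
  also have "\<dots> = (\<Sum>i<n. score t i \<omega>) + real n * (\<Sum>k\<le>S. p0 k * t k)"
    by (simp add: score_def sum_subtractf)
  finally have emp: "(\<Sum>k<S+2. t k * emp_pmf X n \<omega> k)
      = ((\<Sum>i<n. score t i \<omega>) + real n * (\<Sum>k\<le>S. p0 k * t k)) / real n" .
  have "(\<Sum>k<S+2. t k * Wn n \<omega> k) = (\<Sum>k<S+2. sqrt (real n) * (t k * emp_pmf X n \<omega> k - t k * p0 k))"
    by (intro sum.cong) (auto simp: Wn_def algebra_simps)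
  also have "\<dots> = sqrt (real n) * ((\<Sum>i<n. score t i \<omega>) / real n)"
    using False unfolding sum_distrib_left[symmetric] sum_subtractf emp m by (simp add: add_divide_distrib)
  also have "\<dots> = (\<Sum>i<n. score t i \<omega>) / sqrt (real n)"
    using real_div_sqrt[of "real n"] False by (simp add: field_simps)
  finally show ?thesis .
qed (simp add: Wn_def)

lemma score_props:
  shows "indep_vars (\<lambda>_. borel) (score t) UNIV" "integrable M (\<lambda>\<omega>. (score t i \<omega>)\<^sup>2)"
    "expectation (score t i) = 0" "expectation (\<lambda>\<omega>. (score t i \<omega>)\<^sup>2) = score_variance p0 S t"
    "distr M borel (score t i) = distr M borel (score t 0)"
proof -
  define m where "m = (\<Sum>k\<le>S. p0 k * t k)"
  define \<tau> where "\<tau> j = (if j < S + 2 then t j else 0) - m" for j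
  have score: "score t = (\<lambda>i \<omega>. \<tau> (X (Suc i) \<omega>))"
    by (simp add: score_def \<tau>_def m_def fun_eq_iff)
  have [measurable]: "X (Suc i) \<in> measurable M (count_space UNIV)" for i using X_meas by simp
  show "indep_vars (\<lambda>_. borel) (score t) UNIV"
    unfolding score by (rule indep_vars_compose2[OF indep_vars_Suc[OF X_indep]]) simp
  show "integrable M (\<lambda>\<omega>. (score t i \<omega>)\<^sup>2)"
    unfolding score using sample_comp(1)[of "Suc i" "\<lambda>j. (\<tau> j)\<^sup>2"] by simp
  have tau: "\<tau> k = t k - m" if "k \<le> S" for k using that by (simp add: \<tau>_def)
  have "expectation (score t i) = (\<Sum>k\<le>S. p0 k * \<tau> k)"
    unfolding score using sample_comp(2)[of "Suc i" \<tau>] by simp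
  also have "\<dots> = (\<Sum>k\<le>S. p0 k * t k - p0 k * m)"
    by (intro sum.cong) (auto simp: tau algebra_simps)
  also have "\<dots> = 0"
    using total by (simp add: sum_subtractf sum_distrib_right[symmetric] m_def)
  finally show "expectation (score t i) = 0" .
  have "expectation (\<lambda>\<omega>. (score t i \<omega>)\<^sup>2) = (\<Sum>k\<le>S. p0 k * (\<tau> k)\<^sup>2)"
    unfolding score using sample_comp(2)[of "Suc i" "\<lambda>j. (\<tau> j)\<^sup>2"] by simp
  also have "\<dots> = (\<Sum>k\<le>S. p0 k * (t k)\<^sup>2 - 2 * m * (p0 k * t k) + m\<^sup>2 * p0 k)"
    by (intro sum.cong) (auto simp: tau power2_eq_square algebra_simps)
  also have "\<dots> = (\<Sum>k\<le>S. p0 k * (t k)\<^sup>2) - 2 * m * m + m\<^sup>2"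
    by (simp add: sum.distrib sum_subtractf sum_distrib_left[symmetric] m_def total)
  also have "\<dots> = score_variance p0 S t"
    by (simp add: score_variance_def[OF pmf_facts] m_def power2_eq_square)
  finally show "expectation (\<lambda>\<omega>. (score t i \<omega>)\<^sup>2) = score_variance p0 S t" .
  have "distr M (count_space UNIV) (X (Suc i)) = distr M (count_space UNIV) (X (Suc 0))"
  proof (rule measure_eqI_countable)
    fix j :: nat
    have "emeasure (distr M (count_space UNIV) (X (Suc i))) {j} = ennreal (p0 j)" for i
    proof -
      have "X (Suc i) -` {j} \<inter> space M = {\<omega>\<in>space M. X (Suc i) \<omega> = j}" by auto
      then show ?thesis using X_distr by (simp add: emeasure_distr emeasure_eq_measure)
    qed
    then show "emeasure (distr M (count_space UNIV) (X (Suc i))) {j}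
        = emeasure (distr M (count_space UNIV) (X (Suc 0))) {j}" by simp
  qed auto
  then have "distr (distr M (count_space UNIV) (X (Suc i))) borel \<tau>
      = distr (distr M (count_space UNIV) (X (Suc 0))) borel \<tau>" by simp
  then show "distr M borel (score t i) = distr M borel (score t 0)"
    unfolding score by (simp add: distr_distr comp_def)
qed

lemma Wn_measurable: "Wn n \<in> borel_measurable M"
proof -
  have "Wn n = (\<lambda>\<omega>. (\<lambda>q k. if k \<le> S + 1 then sqrt (real n) * (q k - p0 k) else 0) (emp_pmf X n \<omega>))"
    by (simp add: fun_eq_iff Wn_def)
  moreover note sample_function_measurable
    [where h="\<lambda>q k. if k \<le> S + 1 then sqrt (real n) * (q k - p0 k) else 0"]
  ultimately show ?thesis by (simp only:)
qed

definition Q :: "nat \<Rightarrow> 'a \<Rightarrow> real" where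
  "Q n \<omega> = (\<Sum>k\<in>{0..S+1}. (Wn n \<omega> k)\<^sup>2)"

text \<open>A coordinate is the linear functional given by a unit vector, whose variance under
  \<open>p0\<close> is at most the total mass.\<close>

lemma Wn_second_moment:
  assumes k: "k \<le> S + 1"
  shows "integrable M (\<lambda>\<omega>. (Wn n \<omega> k)\<^sup>2) \<and> expectation (\<lambda>\<omega>. (Wn n \<omega> k)\<^sup>2) \<le> 1"
proof -
  define t where "t j = (if j = k then 1 else 0 :: real)" for j
  have pick: "Wn n \<omega> k = (\<Sum>j<S+2. t j * Wn n \<omega> j)" for \<omega>
  proof -
    have "(\<Sum>j<S+2. t j * Wn n \<omega> j) = (\<Sum>j<S+2. if j = k then Wn n \<omega> j else 0)"
      by (intro sum.cong) (auto simp: t_def)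
    then show ?thesis using k by (subst (asm) sum.delta) auto
  qed
  have eq: "(Wn n \<omega> k)\<^sup>2 = (\<Sum>i<n. score t i \<omega>)\<^sup>2 / real n" for \<omega>
    unfolding pick[of \<omega>] Wn_linear by (simp add: power_divide)
  note var = variance_sum_indep[OF score_props(1,2,3,4), of t n]
  have "score_variance p0 S t \<le> (\<Sum>j\<le>S. p0 j * (t j)\<^sup>2)" by (simp add: score_variance_def[OF pmf_facts])
  also have "\<dots> \<le> (\<Sum>j\<le>S. p0 j)" using nonneg by (intro sum_mono) (auto simp: t_def)
  finally have "score_variance p0 S t \<le> 1" using total by simp
  then show ?thesis unfolding eq using var by (cases "n = 0") simp_all
qed

section \<open>Moment bounds, tightness and the multivariate central limit theorem\<close>

lemma Q_nonneg: "0 \<le> Q n \<omega>" by (simp add: Q_def sum_nonneg)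

lemma Q_moment: "integrable M (Q n)" "expectation (Q n) \<le> real (S + 2)"
proof -
  show "integrable M (Q n)" unfolding Q_def
    using Wn_second_moment by (intro Bochner_Integration.integrable_sum) auto
  have "expectation (Q n) = (\<Sum>k\<in>{0..S+1}. expectation (\<lambda>\<omega>. (Wn n \<omega> k)\<^sup>2))" unfolding Q_def
    using Wn_second_moment by (intro Bochner_Integration.integral_sum) auto
  also have "\<dots> \<le> (\<Sum>k\<in>{0..S+1}. 1)" using Wn_second_moment by (intro sum_mono) auto
  finally show "expectation (Q n) \<le> real (S + 2)" by simp
qed

lemma Q_tail:
  assumes "0 < c"
  shows "prob {\<omega>\<in>space M. c \<le> Q n \<omega>} \<le> real (S + 2) / c"
proof -
  have "prob {\<omega>\<in>space M. c \<le> Q n \<omega>} \<le> expectation (Q n) / c"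
    by (rule integral_Markov_inequality_measure[OF Q_moment(1), of "{}"]) (use assms Q_nonneg in auto)
  also have "\<dots> \<le> real (S + 2) / c" using Q_moment(2) assms by (intro divide_right_mono) auto
  finally show ?thesis .
qed

lemma Wn_tight:
  assumes e: "0 < e"
  shows "\<exists>L0. \<forall>L\<ge>L0. \<forall>\<^sub>F n in sequentially. prob {\<omega>\<in>space M. Wn n \<omega> \<notin> cube (S + 2) L} < e"
proof (intro exI allI impI)
  \<comment> \<open>As \<open>L\<close> is at least one, \<open>L\<close> is at most its square, and
    the Markov bound for \<open>Q n\<close> at the level of this square falls below
    \<open>e\<close>.\<close>
  fix L assume L: "1 + real (S + 2) / e \<le> L"
  then have L1: "1 \<le> L" using e by (smt (verit) divide_nonneg_pos of_nat_0_le_iff)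
  then have "L * 1 \<le> L\<^sup>2" unfolding power2_eq_square by (intro mult_left_mono) auto
  then have "real (S + 2) / e < L\<^sup>2" using L by linarith
  then have small: "real (S + 2) / L\<^sup>2 < e" using e L1 by (simp add: field_simps)
  have Qm: "Q n \<in> borel_measurable M" for n using Q_moment(1) by (rule borel_measurable_integrable)
  have "prob {\<omega>\<in>space M. Wn n \<omega> \<notin> cube (S + 2) L} < e" for n
  proof -
    have "L\<^sup>2 \<le> Q n \<omega>" if out: "Wn n \<omega> \<notin> cube (S + 2) L" for \<omega>
    proof -
      have "\<forall>k\<ge>S+2. Wn n \<omega> k = 0" by (simp add: Wn_def)
      then obtain k where k: "k < S + 2" "L < \<bar>Wn n \<omega> k\<bar>"
        using out unfolding cube_iff by (meson not_le)
      then have "L\<^sup>2 \<le> (Wn n \<omega> k)\<^sup>2" using L1 by (simp add: abs_le_square_iff[symmetric])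
      also have "\<dots> \<le> Q n \<omega>" unfolding Q_def using k by (intro member_le_sum) auto
      finally show ?thesis .
    qed
    then have "prob {\<omega>\<in>space M. Wn n \<omega> \<notin> cube (S + 2) L} \<le> prob {\<omega>\<in>space M. L\<^sup>2 \<le> Q n \<omega>}"
      using Qm by (intro finite_measure_mono) auto
    also have "\<dots> \<le> real (S + 2) / L\<^sup>2" using L1 by (intro Q_tail) auto
    finally show ?thesis using small by linarith
  qed
  then show "\<forall>\<^sub>F n in sequentially. prob {\<omega>\<in>space M. Wn n \<omega> \<notin> cube (S + 2) L} < e" by simp
qed

lemma Wn_conv_distr:
  assumes bb: "brownian_bridge N U"
  shows "conv_distr M Wn N (\<lambda>\<omega>. Wvec p0 (U \<omega>))"
proof (rule weak_convergence_trig[where d="S + 2"])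
  show "prob_space M" by (rule prob_space_axioms)
  show "prob_space N" using bb by (simp add: brownian_bridge_def)
  show "Wvec p0 (U \<omega>) k = 0" if "\<omega> \<in> space N" "S + 2 \<le> k" for \<omega> k
    using Wvec_zero[OF pmf_facts, of "U \<omega>" k] that bb by (simp add: brownian_bridge_def)
  show "(\<lambda>n. expectation (\<lambda>\<omega>. cos ((\<Sum>k<S+2. t k * Wn n \<omega> k) + \<phi>)))
      \<longlonglongrightarrow> (\<integral>\<omega>. cos ((\<Sum>k<S+2. t k * Wvec p0 (U \<omega>) k) + \<phi>) \<partial>N)" for t \<phi>
    unfolding Wn_linear Wvec_expectation_cos[OF pmf_facts bb]
    by (rule tendsto_cos_sum_iid[OF prob_space_axioms score_props])
qed (simp_all only: Wn_measurable Wvec_measurable[OF pmf_facts bb] Wn_tight)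

text \<open>Off this event the empirical frequencies are supported in \<open>{0..S}\<close> and lie
  within \<open>d\<close> of \<open>p0\<close>, since on \<open>{0..S+1}\<close> the value
  \<open>Q n\<close> is \<open>n\<close> times the squared distance.\<close>

definition bad :: "real \<Rightarrow> nat \<Rightarrow> 'a set" where
  "bad d n = {\<omega>\<in>space M. \<not> (\<forall>i\<in>{1..n}. X i \<omega> \<le> S) \<or> real n * d\<^sup>2 \<le> Q n \<omega>}"

lemma bad_null:
  assumes d: "0 < d"
  shows "bad d n \<in> events" "(\<lambda>n. prob (bad d n)) \<longlonglongrightarrow> 0"
proof -
  have Qm [measurable]: "Q n \<in> borel_measurable M" for n
    using Q_moment(1) by (rule borel_measurable_integrable)
  have E1: "{\<omega>\<in>space M. \<forall>i\<in>{1..n}. X i \<omega> \<le> S} \<in> events" for n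
  proof (rule sets.sets_Collect_finite_All)
    fix i assume "i \<in> {1..n}"
    then have "X i \<in> measurable M (count_space UNIV)" using X_meas by simp
    then show "{\<omega>\<in>space M. X i \<omega> \<le> S} \<in> events" by measurable
  qed simp
  have E2: "{\<omega>\<in>space M. real n * d\<^sup>2 \<le> Q n \<omega>} \<in> events" for n by measurable
  show "bad d n \<in> events" for n
    unfolding bad_def by (intro sets.sets_Collect_disj sets.sets_Collect_neg E1 E2)
  show "(\<lambda>n. prob (bad d n)) \<longlonglongrightarrow> 0"
  proof (rule Lim_null_comparison)
    show "\<forall>\<^sub>F n in sequentially. norm (prob (bad d n)) \<le> (real (S + 2) / d\<^sup>2) * (1 / real n)"
    proof (rule eventually_sequentiallyI[of 1])
      fix n :: nat assume n: "1 \<le> n"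
      have "AE \<omega> in M. \<omega> \<in> bad d n \<longrightarrow> \<omega> \<in> {\<omega>\<in>space M. real n * d\<^sup>2 \<le> Q n \<omega>}"
        using AE_sample_le by eventually_elim (auto simp: bad_def)
      then have "prob (bad d n) \<le> prob {\<omega>\<in>space M. real n * d\<^sup>2 \<le> Q n \<omega>}"
        by (rule finite_measure_mono_AE) (rule E2)
      also have "\<dots> \<le> real (S + 2) / (real n * d\<^sup>2)" using n d by (intro Q_tail) auto
      finally show "norm (prob (bad d n)) \<le> (real (S + 2) / d\<^sup>2) * (1 / real n)"
        by (simp add: measure_nonneg field_simps)
    qed
    show "(\<lambda>n. (real (S + 2) / d\<^sup>2) * (1 / real n)) \<longlonglongrightarrow> 0"
      using tendsto_mult_left[OF lim_1_over_n, of "real (S + 2) / d\<^sup>2"] by simp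
  qed
qed

lemma hat_p_off_bad:
  assumes cvx: "convex_seq p0"
    and d: "0 < d" "\<And>k. k \<in> knotset p0 S \<Longrightarrow> 4 * d \<le> dd p0 k" "4 * d \<le> p0 S"
    and \<omega>: "\<omega> \<in> space M" "\<omega> \<notin> bad d n" and n: "1 \<le> n"
  shows "hat_p (emp_pmf X n \<omega>) = (\<lambda>k. p0 k + ghat p0 S (Wn n \<omega>) k / sqrt (real n))"
proof (rule hat_p_eq_ghat[OF cvx supp d(2,3)])
  have le: "X i \<omega> \<le> S" if "i \<in> {1..n}" for i using \<omega> that by (auto simp: bad_def)
  show "emp_pmf X n \<omega> k = 0" if "S < k" for k
    using le that by (fastforce simp: emp_pmf_def)
  have "Q n \<omega> = real n * (\<Sum>k\<in>{0..S+1}. (emp_pmf X n \<omega> k - p0 k)\<^sup>2)"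
    unfolding Q_def sum_distrib_left by (intro sum.cong) (auto simp: Wn_def power_mult_distrib)
  moreover have "Q n \<omega> \<le> real n * d\<^sup>2" using \<omega> by (simp add: bad_def)
  ultimately show "(\<Sum>k\<in>{0..S+1}. (emp_pmf X n \<omega> k - p0 k)\<^sup>2) \<le> d\<^sup>2"
    using n by (simp del: sum.cl_ivl_Suc)
qed (use d n in \<open>auto simp: Wn_def\<close>)

text \<open>Off the vanishing event \<open>bad\<close> the estimator has its local form, so the
  functional may be replaced by \<open>h\<close> of \<open>Wn\<close>, to which the central limit
  theorem applies. The tails and the defect are both treated this way.\<close>

lemma expectation_tendsto_limit:
  fixes h :: "(nat \<Rightarrow> real) \<Rightarrow> real" and g :: "nat \<Rightarrow> (nat \<Rightarrow> real) \<Rightarrow> real"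
  assumes cvx: "convex_seq p0" and bb: "brownian_bridge N U"
    and h: "continuous_on UNIV h" "\<And>x. \<bar>h x\<bar> \<le> B"
    and g: "\<And>q n. \<bar>g n q\<bar> \<le> B"
    and eq: "\<And>n \<omega>. 1 \<le> n \<Longrightarrow> hat_p (emp_pmf X n \<omega>) = (\<lambda>k. p0 k + ghat p0 S (Wn n \<omega>) k / sqrt (real n))
        \<Longrightarrow> g n (emp_pmf X n \<omega>) = h (Wn n \<omega>)"
  shows "(\<lambda>n. expectation (\<lambda>\<omega>. g n (emp_pmf X n \<omega>))) \<longlonglongrightarrow> (\<integral>\<omega>. h (Wvec p0 (U \<omega>)) \<partial>N)"
proof -
  obtain d where d: "0 < d" "\<And>k. k \<in> knotset p0 S \<Longrightarrow> 4 * d \<le> dd p0 k" "4 * d \<le> p0 S"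
    using hat_p_local_margin[OF cvx supp nonneg] by blast
  have "h \<in> borel_measurable borel" using h(1) by (rule borel_measurable_continuous_onI)
  then have hm: "(\<lambda>\<omega>. h (Wn n \<omega>)) \<in> borel_measurable M" for n
    using Wn_measurable by (rule measurable_compose_rev)
  have "(\<lambda>n. expectation (\<lambda>\<omega>. g n (emp_pmf X n \<omega>)) - expectation (\<lambda>\<omega>. h (Wn n \<omega>))) \<longlonglongrightarrow> 0"
    by (rule integral_diff_tendsto_0[where B=B and E="bad d"])
       (use g h(2) hm eq hat_p_off_bad[OF cvx d] bad_null[OF d(1)] sample_function_measurable in auto)
  moreover have "(\<lambda>n. expectation (\<lambda>\<omega>. h (Wn n \<omega>))) \<longlonglongrightarrow> (\<integral>\<omega>. h (Wvec p0 (U \<omega>)) \<partial>N)"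
    using Wn_conv_distr[OF bb] h unfolding conv_distr_def bounded_iff by auto
  ultimately show ?thesis using tendsto_add by fastforce
qed

lemma conv_distr_iff_o_p:
  assumes cvx: "convex_seq p0" and s: "s \<in> knotset p0 S" and bb: "brownian_bridge N U"
  shows "conv_distr M
        (\<lambda>n \<omega> k. if k \<in> {s..S+1}
                   then sqrt (real n) * (hat_p (emp_pmf X n \<omega>) k - p0 k) else 0)
        N (\<lambda>\<omega>. gmin_ge p0 S s (Wvec p0 (U \<omega>)))
      \<longleftrightarrow>
      o_p_one M (\<lambda>n \<omega>. sqrt (real n) *
         (Fp (hat_p (emp_pmf X n \<omega>)) (int s - 1) - Fp (emp_pmf X n \<omega>) (int s - 1)))"
    (is "conv_distr M ?H N ?Z \<longleftrightarrow> o_p_one M ?R")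
proof -
  interpret N: prob_space N using bb by (simp add: brownian_bridge_def)
  define W where "W \<omega> = Wvec p0 (U \<omega>)" for \<omega>
  define D where "D = defect p0 S s"
  define T where "T = ghat_tail p0 S s"
  note contD = continuous_on_defect[OF s, folded D_def]
  note contT = continuous_on_ghat_tail[OF s, folded T_def]
  have W: "W \<in> borel_measurable N" unfolding W_def by (rule Wvec_measurable[OF pmf_facts bb])
  \<comment> \<open>As \<open>s \<ge> 1\<close>, the integer \<open>s - 1\<close> is nonnegative and
    the sum runs over \<open>k < s\<close>, the range of the defect.\<close>
  have Fp_pre: "Fp p (int s - 1) = (\<Sum>k<s. p k)" for p
  proof -
    obtain r where r: "s = Suc r" using s_bounds[OF s] by (cases s) auto
    show ?thesis by (simp add: r Fp_def lessThan_Suc_atMost)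
  qed
  have R_meas: "?R n \<in> borel_measurable M" for n
    by (rule sample_function_measurable
      [where h="\<lambda>q. sqrt (real n) * (Fp (hat_p q) (int s - 1) - Fp q (int s - 1))"])
  have lim_T: "(\<lambda>n. expectation (\<lambda>\<omega>. f (?H n \<omega>))) \<longlonglongrightarrow> (\<integral>\<omega>. f (T (W \<omega>)) \<partial>N)"
    if f: "continuous_on UNIV f" "\<And>x. \<bar>f x\<bar> \<le> B" for f :: "(nat \<Rightarrow> real) \<Rightarrow> real" and B
    unfolding W_def
  proof (rule expectation_tendsto_limit[OF cvx bb, where B=B and h="\<lambda>w. f (T w)" and
        g="\<lambda>n q. f (\<lambda>k. if k \<in> {s..S+1} then sqrt (real n) * (hat_p q k - p0 k) else 0)"])
    show "continuous_on UNIV (\<lambda>w. f (T w))"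
      by (rule continuous_on_compose2[OF f(1) contT]) simp
    fix n :: nat and \<omega>
    assume n: "1 \<le> n"
      and "hat_p (emp_pmf X n \<omega>) = (\<lambda>k. p0 k + ghat p0 S (Wn n \<omega>) k / sqrt (real n))"
    then have "?H n \<omega> = T (Wn n \<omega>)" by (auto simp: T_def ghat_tail_def[OF s] fun_eq_iff)
    then show "f (?H n \<omega>) = f (T (Wn n \<omega>))" by (rule arg_cong)
  qed (rule f)+
  have lim_D: "(\<lambda>n. expectation (\<lambda>\<omega>. min 1 \<bar>?R n \<omega>\<bar>)) \<longlonglongrightarrow> (\<integral>\<omega>. min 1 \<bar>D (W \<omega>)\<bar> \<partial>N)"
    unfolding W_def
  proof (rule expectation_tendsto_limit[OF cvx bb, where B=1 and h="\<lambda>w. min 1 \<bar>D w\<bar>" and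
        g="\<lambda>n q. min 1 \<bar>sqrt (real n) * (Fp (hat_p q) (int s - 1) - Fp q (int s - 1))\<bar>"])
    show "continuous_on UNIV (\<lambda>w. min 1 \<bar>D w\<bar>)" by (intro continuous_intros contD)
    fix n :: nat and \<omega>
    assume n: "1 \<le> n"
      and hp: "hat_p (emp_pmf X n \<omega>) = (\<lambda>k. p0 k + ghat p0 S (Wn n \<omega>) k / sqrt (real n))"
    have "?R n \<omega> = (\<Sum>k<s. sqrt (real n) * (hat_p (emp_pmf X n \<omega>) k - emp_pmf X n \<omega> k))"
      unfolding Fp_pre by (simp only: sum_subtractf[symmetric] sum_distrib_left)
    \<comment> \<open>The terms with \<open>p0\<close> cancel, and \<open>k < s \<le> S\<close> lies
      in the range where \<open>Wn\<close> is not cut off.\<close>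
    also have "\<dots> = D (Wn n \<omega>)" unfolding D_def defect_def[OF s]
      using n s_bounds[OF s] by (intro sum.cong) (auto simp: hp Wn_def algebra_simps)
    finally show "min 1 \<bar>?R n \<omega>\<bar> = min 1 \<bar>D (Wn n \<omega>)\<bar>" by simp
  qed auto
  have meas: "(\<lambda>\<omega>. h (W \<omega>)) \<in> borel_measurable N" if "continuous_on UNIV h" for h :: "(nat \<Rightarrow> real) \<Rightarrow> real"
    using borel_measurable_continuous_onI[OF that] W by (rule measurable_compose_rev)
  have "o_p_one M ?R \<longleftrightarrow> (\<integral>\<omega>. min 1 \<bar>D (W \<omega>)\<bar> \<partial>N) = 0"
  proof
    assume "o_p_one M ?R"
    then show "(\<integral>\<omega>. min 1 \<bar>D (W \<omega>)\<bar> \<partial>N) = 0"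
      using LIMSEQ_unique[OF lim_D] unfolding o_p_one_iff[where R="?R", OF R_meas] by blast
  next
    assume "(\<integral>\<omega>. min 1 \<bar>D (W \<omega>)\<bar> \<partial>N) = 0"
    with lim_D show "o_p_one M ?R"
      unfolding o_p_one_iff[where R="?R", OF R_meas] by (simp only:)
  qed
  also have "\<dots> \<longleftrightarrow> (AE \<omega> in N. min 1 \<bar>D (W \<omega>)\<bar> = 0)"
    by (rule integral_nonneg_eq_0_iff_AE)
       (auto intro!: N.integrable_const_bound[of _ 1] meas continuous_intros contD)
  also have "\<dots> \<longleftrightarrow> (AE \<omega> in N. D (W \<omega>) = 0)" by (intro AE_cong) (auto simp: min_def)
  finally have op: "o_p_one M ?R \<longleftrightarrow> (AE \<omega> in N. D (W \<omega>) = 0)" .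
  have "conv_distr M ?H N ?Z \<longleftrightarrow> (AE \<omega> in N. D (W \<omega>) = 0)"
  proof
    assume conv: "conv_distr M ?H N ?Z"
    \<comment> \<open>The test function is bounded through \<open>arctan\<close>, and strictly
      increasing in the total mass of the tail, so equal values give back equal masses.\<close>
    define f where "f x = arctan (\<Sum>k\<in>{s..S+1}. x k)" for x :: "nat \<Rightarrow> real"
    have coord: "continuous_on UNIV (\<lambda>x :: nat \<Rightarrow> real. x k)" for k
      by (rule continuous_on_product_coordinates)
    have f: "continuous_on UNIV f" unfolding f_def by (intro continuous_intros coord)
    have fB: "\<bar>f x\<bar> \<le> pi / 2" for x
      using arctan_bounded[of "\<Sum>k\<in>{s..S+1}. x k"] unfolding f_def by linarith
    have "bounded (range f)" unfolding bounded_iff by (intro exI[of _ "pi / 2"]) (use fB in auto)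
    with conv f have "(\<lambda>n. expectation (\<lambda>\<omega>. f (?H n \<omega>))) \<longlonglongrightarrow> (\<integral>\<omega>. f (?Z \<omega>) \<partial>N)"
      unfolding conv_distr_def by blast
    then have eq: "(\<integral>\<omega>. f (?Z \<omega>) \<partial>N) = (\<integral>\<omega>. f (T (W \<omega>)) \<partial>N)"
      using lim_T[OF f fB] LIMSEQ_unique by blast
    define Y where "Y \<omega> = (\<Sum>k\<in>{s..S+1}. W \<omega> k)" for \<omega>
    have Z: "f (?Z \<omega>) = arctan (Y \<omega>)" for \<omega>
      using sum_gmin_ge[OF s, of "W \<omega>"] unfolding f_def Y_def W_def by (simp only:)
    have TW: "f (T (W \<omega>)) = arctan (Y \<omega> - D (W \<omega>))" for \<omega>
      using sum_ghat_tail[OF s, of "W \<omega>"] unfolding f_def Y_def T_def D_def by (simp only:)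
    have mY: "(\<lambda>\<omega>. arctan (Y \<omega>)) \<in> borel_measurable N"
      "(\<lambda>\<omega>. arctan (Y \<omega> - D (W \<omega>))) \<in> borel_measurable N"
      unfolding Y_def by (intro meas continuous_intros contD coord)+
    have bY: "\<bar>arctan y\<bar> \<le> pi / 2" for y using arctan_bounded[of y] by linarith
    have int: "integrable N (\<lambda>\<omega>. arctan (Y \<omega>))" "integrable N (\<lambda>\<omega>. arctan (Y \<omega> - D (W \<omega>)))"
      by (rule N.integrable_const_bound[of _ "pi / 2"]; use bY mY in simp)+
    \<comment> \<open>The sign of \<open>D\<close> orders the two variables pointwise, and ordered
      variables with equal expectations agree almost surely.\<close>
    have "AE \<omega> in N. arctan (Y \<omega>) = arctan (Y \<omega> - D (W \<omega>))"
    proof (rule integral_ineq_eq_0_then_AE[OF _ int])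
      show "AE \<omega> in N. arctan (Y \<omega>) \<le> arctan (Y \<omega> - D (W \<omega>))"
        unfolding D_def using defect_nonpos[OF s]
        by (intro AE_I2 arctan_monotone') (simp add: le_diff_eq)
      show "(\<integral>\<omega>. arctan (Y \<omega>) \<partial>N) = (\<integral>\<omega>. arctan (Y \<omega> - D (W \<omega>)) \<partial>N)"
        using eq by (simp only: Z TW)
    qed
    then show "AE \<omega> in N. D (W \<omega>) = 0"
      by eventually_elim (simp add: arctan_eq_iff)
  next
    assume AE0: "AE \<omega> in N. D (W \<omega>) = 0"
    show "conv_distr M ?H N ?Z" unfolding conv_distr_def
    proof (intro allI impI)
      fix f :: "(nat \<Rightarrow> real) \<Rightarrow> real" assume f: "continuous_on UNIV f \<and> bounded (range f)"
      then obtain B where B: "\<And>x. \<bar>f x\<bar> \<le> B" unfolding bounded_iff by auto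
      have "(\<integral>\<omega>. f (T (W \<omega>)) \<partial>N) = (\<integral>\<omega>. f (?Z \<omega>) \<partial>N)"
      proof (rule integral_cong_AE)
        show "(\<lambda>\<omega>. f (T (W \<omega>))) \<in> borel_measurable N"
          by (rule meas, rule continuous_on_compose2[OF conjunct1[OF f] contT]) simp
        show "(\<lambda>\<omega>. f (?Z \<omega>)) \<in> borel_measurable N"
          unfolding W_def[symmetric]
          by (rule meas, rule continuous_on_compose2[OF conjunct1[OF f] continuous_on_gmin_ge[OF s]]) simp
        show "AE \<omega> in N. f (T (W \<omega>)) = f (?Z \<omega>)"
          using AE0 by eventually_elim (simp add: T_def D_def W_def ghat_tail_eq_gmin_ge[OF s])
      qed
      then show "(\<lambda>n. expectation (\<lambda>\<omega>. f (?H n \<omega>))) \<longlonglongrightarrow> (\<integral>\<omega>. f (?Z \<omega>) \<partial>N)"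
        using lim_T[of f B] f B by simp
    qed
  qed
  with op show ?thesis by simp
qed

end

theorem theorem5:
  fixes p0 :: "nat \<Rightarrow> real" and S s :: nat
    and M :: "'a measure" and X :: "nat \<Rightarrow> 'a \<Rightarrow> nat"
    and N :: "'b measure" and U :: "'b \<Rightarrow> real \<Rightarrow> real"
  assumes S_ge: "S \<ge> 1"
    and p0_convex: "convex_seq p0"
    and p0_nonneg: "\<forall>k. p0 k \<ge> 0"
    and p0_support: "{k. p0 k \<noteq> 0} = {0..S}"
    and p0_sum: "(\<Sum>k\<le>S. p0 k) = 1"
    and m_ge: "knotset p0 S \<noteq> {}"
    and s_knot: "s \<in> knotset p0 S"
    and M_prob: "prob_space M"
    and X_meas: "\<forall>i\<ge>1. X i \<in> measurable M (count_space UNIV)"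
    and X_indep: "prob_space.indep_vars M (\<lambda>_. count_space UNIV) X {1..}"
    and X_distr: "\<forall>i\<ge>1. \<forall>j. measure M {\<omega>\<in>space M. X i \<omega> = j} = p0 j"
    and U_bb: "brownian_bridge N U"
  shows
    "(\<forall>\<omega>\<in>space N.
        (\<exists>!g. g \<in> CKge p0 S s \<and>
           (\<forall>g'\<in>CKge p0 S s. Phi_ge S s (Wvec p0 (U \<omega>)) g \<le> Phi_ge S s (Wvec p0 (U \<omega>)) g'))
      \<and> ((\<forall>k\<in>{s..S+1}. gmin_ge p0 S s (Wvec p0 (U \<omega>)) k = ghat p0 S (Wvec p0 (U \<omega>)) k)
           \<longleftrightarrow> Ghat p0 S (Wvec p0 (U \<omega>)) (s - 1) = U \<omega> (Fp p0 (int s - 1))))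
     \<and>
     (conv_distr M
        (\<lambda>n \<omega> k. if k \<in> {s..S+1}
                   then sqrt (real n) * (hat_p (emp_pmf X n \<omega>) k - p0 k) else 0)
        N (\<lambda>\<omega>. gmin_ge p0 S s (Wvec p0 (U \<omega>)))
      \<longleftrightarrow>
      o_p_one M (\<lambda>n \<omega>. sqrt (real n) *
         (Fp (hat_p (emp_pmf X n \<omega>)) (int s - 1) - Fp (emp_pmf X n \<omega>) (int s - 1))))"
proof (intro conjI ballI)
  interpret iid_sample M X p0 S
    by (intro iid_sample.intro iid_sample_axioms.intro assms)
  fix \<omega> assume \<omega>: "\<omega> \<in> space N"
  show "\<exists>!g. g \<in> CKge p0 S s \<and>
      (\<forall>g'\<in>CKge p0 S s. Phi_ge S s (Wvec p0 (U \<omega>)) g \<le> Phi_ge S s (Wvec p0 (U \<omega>)) g')"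
    by (rule ex1_gmin_ge[OF s_knot])
  have "U \<omega> 0 = 0" using U_bb \<omega> by (simp add: brownian_bridge_def)
  moreover have "{..s - 1} = {..<s}" using s_bounds[OF s_knot] by auto
  \<comment> \<open>The increments before \<open>s\<close> telescope to the bridge at the
    distribution function of \<open>s - 1\<close>, because the bridge starts at zero.\<close>
  ultimately have "defect p0 S s (Wvec p0 (U \<omega>))
      = Ghat p0 S (Wvec p0 (U \<omega>)) (s - 1) - U \<omega> (Fp p0 (int s - 1))"
    by (simp add: defect_def[OF s_knot] Ghat_def sum_subtractf Wvec_sum[OF pmf_facts])
  then show "(\<forall>k\<in>{s..S+1}. gmin_ge p0 S s (Wvec p0 (U \<omega>)) k = ghat p0 S (Wvec p0 (U \<omega>)) k)
      \<longleftrightarrow> Ghat p0 S (Wvec p0 (U \<omega>)) (s - 1) = U \<omega> (Fp p0 (int s - 1))"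
    unfolding gmin_ge_agrees_ghat_iff[OF s_knot] by simp
next
  interpret iid_sample M X p0 S
    by (intro iid_sample.intro iid_sample_axioms.intro assms)
  show "conv_distr M
        (\<lambda>n \<omega> k. if k \<in> {s..S+1}
                   then sqrt (real n) * (hat_p (emp_pmf X n \<omega>) k - p0 k) else 0)
        N (\<lambda>\<omega>. gmin_ge p0 S s (Wvec p0 (U \<omega>)))
      \<longleftrightarrow>
      o_p_one M (\<lambda>n \<omega>. sqrt (real n) *
         (Fp (hat_p (emp_pmf X n \<omega>)) (int s - 1) - Fp (emp_pmf X n \<omega>) (int s - 1)))"
    by (rule conv_distr_iff_o_p[OF p0_convex s_knot U_bb])
qed

end
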